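(* Let $m\ge 1$, $0\le s\le m$ and let $k\ge 0$ be an integer. Let $\operatorname{Ker}^s_k\Delta=H^s_k\oplus U^s_k\oplus V^s_k\oplus W^s_k$ be the decomposition, into $O(m)$-submodules each irreducible or zero, of the space of harmonic homogeneous polynomial $s$-forms of degree $k$ on $\mathbf R^m$, as described in the context. Then the following hold (with $\simeq$ denoting isomorphism of $O(m)$-modules): (a) $U_k^s\simeq\operatorname{Ker}_k^s(dd^* )/\operatorname{Ker}^s_k d^*$ and $V_k^s\simeq\operatorname{Ker}_k^s(d^*d)/\operatorname{Ker}^s_k d$; (b) $W_k^s\simeq\operatorname{Ker}_k^s\Delta\,/\left(\operatorname{Ker}_k^s(dd^* )\cap\operatorname{Ker}_k^s(d^*d)\right)$; (c) $\operatorname{Ker}_k^s(dd^* )\cap\operatorname{Ker}_k^s d=H^s_k\oplus U^s_k$ and $\operatorname{Ker}_k^s(d^*d)\cap\operatorname{Ker}_k^s d^*=H^s_k\oplus V_k^s$; (d) $\operatorname{Ker}_k^s(dd^* )\cap\operatorname{Ker}_k^s(d^*d)=H^s_k\oplus U^s_k\oplus V^s_k$.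
   Context: For $k\ge 0$, $\mathcal P_k$ is the space of real-valued polynomials on $\mathbf R^m$ homogeneous of degree $k$. For $0\le s\le m$, $\mathcal P^s_k=\mathcal P_k\otimes_{\mathbf R}\Lambda^s(\mathbf R^m)$ is the space of differential $s$-forms on $\mathbf R^m$ whose coefficients are in $\mathcal P_k$; $O(m)$ acts on it in the natural way. The operator $d$ is the de Rham differential, $d^*$ its formal adjoint (the codifferential) with respect to the Euclidean metric, and $\Delta$ is the Hodge Laplacian, $\Delta=dd^*+d^*d$ (up to sign, the coefficientwise Laplacian). For an operator $T$ on differential forms, $\operatorname{Ker}^s_k T=\{P\in\mathcal P^s_k:\ TP=0\}$. Put $$H^s_k=\{P\in\mathcal P^s_k:\ dP=0,\ d^*P=0\}.$$ Known facts (Homma) used to define $U^s_k,V^s_k,W^s_k$: each $H^s_k$ ($0\le s\le m$, $k\ge0$) is either zero or an irreducible $O(m)$-module, it is zero exactly when $s\in\{0,m\}$ and $k\ge 1$, and the nonzero modules $H^s_k$ for distinct pairs $(s,k)$ are pairwise inequivalent. Moreover, there is a direct sum decomposition into $O(m)$-submodules $$\operatorname{Ker}_k^s\Delta=H^s_k\oplus U^s_k\oplus V^s_k\oplus W^s_k$$ with: - $U^s_k\simeq H^{s-1}_{k-1}$ for $1\le s\le m$, $k\ge1$, and $U^0_k=\{0\}$; - $V^s_k\simeq H^{s+1}_{k-1}$ for $0\le s\le m-1$, $k\ge 1$, and $V^m_k=\{0\}$; - $W^s_k\simeq H^s_{k-2}$ for $1\le s\le m-1$, $k\ge2$, and $W^s_1=\{0\}$,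 $W^0_k=\{0\}$, $W^m_k=\{0\}$; - for $k=0$, $U^s_0=V^s_0=W^s_0=\{0\}$. Since the summands are pairwise inequivalent, the subspaces $U^s_k$, $V^s_k$, $W^s_k$ of $\operatorname{Ker}^s_k\Delta$ are uniquely determined by these properties. *)

theory Defs
  imports "HOL-Analysis.Analysis" "HOL-Library.Function_Algebras"
begin

section \<open>Pointwise vector space structure on functions\<close>

instantiation "fun" :: (type, real_vector) real_vector
begin

definition scaleR_fun :: "real \<Rightarrow> ('a \<Rightarrow> 'b) \<Rightarrow> 'a \<Rightarrow> 'b"
  where "scaleR_fun c f = (\<lambda>x. c *\<^sub>R f x)"

instance
  by standard (simp_all add: scaleR_fun_def fun_eq_iff scaleR_add_right scaleR_add_left)

end

lemma scaleR_fun_apply [simp]: "(c *\<^sub>R f) x = c *\<^sub>R f x"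
  by (simp add: scaleR_fun_def)

section \<open>Polynomial differential forms\<close>

text \<open>
  The space \<open>\<real>\<^sup>m\<close> is \<^typ>\<open>real^'n\<close> with \<open>m = CARD('n)\<close>. A differential form assigns to each
  point a function on lists of vectors; a form of degree \<open>s\<close> is alternating and multilinear
  on lists of length \<open>s\<close> and, so that equality of forms is equality of functions, is 0 on
  lists of any other length.
\<close>

type_synonym 'n form = "real^'n \<Rightarrow> (real^'n) list \<Rightarrow> real"

definition alternating_form :: "nat \<Rightarrow> ((real^'n) list \<Rightarrow> real) \<Rightarrow> bool"
  where "alternating_form s \<alpha> \<longleftrightarrow>
    (\<forall>vs. length vs \<noteq> s \<longrightarrow> \<alpha> vs = 0) \<and>
    (\<forall>vs i. length vs = s \<longrightarrow> i < s \<longrightarrow> linear (\<lambda>v. \<alpha> (vs[i := v]))) \<and>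
    (\<forall>vs i j. length vs = s \<longrightarrow> i < j \<longrightarrow> j < s \<longrightarrow> vs ! i = vs ! j \<longrightarrow> \<alpha> vs = 0)"

definition homogeneous_polynomial :: "nat \<Rightarrow> (real^'n \<Rightarrow> real) \<Rightarrow> bool"
  where "homogeneous_polynomial k p \<longleftrightarrow>
    real_polynomial_function p \<and> (\<forall>c x. p (c *\<^sub>R x) = c ^ k * p x)"

text \<open>
  The coefficients of \<open>\<omega>\<close> are the functions \<open>\<lambda>x. \<omega> x vs\<close> with \<open>vs\<close> a list of standard basis
  vectors; by multilinearity they are homogeneous polynomials of degree \<open>k\<close> if and only if
  this holds for all \<open>vs\<close>.
\<close>

definition poly_forms :: "nat \<Rightarrow> nat \<Rightarrow> 'n::finite form set"
  where "poly_forms s k = {\<omega>. (\<forall>x. alternating_form s (\<omega> x)) \<and>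
    (\<forall>vs. homogeneous_polynomial k (\<lambda>x. \<omega> x vs))}"

section \<open>The de Rham differential, the codifferential and the Hodge Laplacian\<close>

definition dform :: "'n::finite form \<Rightarrow> 'n form"
  where "dform \<omega> = (\<lambda>x vs. \<Sum>i<length vs.
    (-1) ^ i * frechet_derivative (\<lambda>y. \<omega> y (take i vs @ drop (Suc i) vs)) (at x) (vs ! i))"

text \<open>
  In the standard orthonormal frame \<open>d = (\<Sum>j. dx\<^sub>j \<and> \<partial>\<^sub>j)\<close>, so that the formal adjoint of \<open>d\<close> is
  \<open>-(\<Sum>j. \<iota>(e\<^sub>j) \<partial>\<^sub>j)\<close> with \<open>\<iota>\<close> the interior product. That \<open>codiff\<close> is indeed adjoint to
  \<open>dform\<close> for the \<open>L\<^sup>2\<close> inner product is the lemma \<open>codiff_formal_adjoint\<close> below.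
\<close>

definition codiff :: "'n::finite form \<Rightarrow> 'n form"
  where "codiff \<omega> = (\<lambda>x vs. - (\<Sum>j\<in>UNIV.
    frechet_derivative (\<lambda>y. \<omega> y (axis j 1 # vs)) (at x) (axis j 1)))"

definition hodge_laplacian :: "'n::finite form \<Rightarrow> 'n form"
  where "hodge_laplacian \<omega> = dform (codiff \<omega>) + codiff (dform \<omega>)"

definition Ker :: "nat \<Rightarrow> nat \<Rightarrow> ('n::finite form \<Rightarrow> 'n form) \<Rightarrow> 'n form set"
  where "Ker s k T = {\<omega> \<in> poly_forms s k. T \<omega> = 0}"

definition Hspace :: "nat \<Rightarrow> nat \<Rightarrow> 'n::finite form set"
  where "Hspace s k = {\<omega> \<in> poly_forms s k. dform \<omega> = 0 \<and> codiff \<omega> = 0}"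

subsection \<open>The codifferential is the formal adjoint of the differential\<close>

text \<open>
  The inner product for which the \<open>dx\<^sub>I\<close>, \<open>I\<close> strictly increasing of length \<open>s\<close>, are
  orthonormal; the factor \<open>1 / s!\<close> accounts for summing over all multi-indices.
\<close>

definition form_inner :: "nat \<Rightarrow> ((real^'n::finite) list \<Rightarrow> real) \<Rightarrow> ((real^'n) list \<Rightarrow> real) \<Rightarrow> real"
  where "form_inner s \<alpha> \<beta> = (\<Sum>js | length js = s.
    \<alpha> (map (\<lambda>j::'n. axis j 1) js) * \<beta> (map (\<lambda>j. axis j 1) js)) / fact s"

definition C1_form :: "nat \<Rightarrow> 'n::finite form \<Rightarrow> bool"
  where "C1_form s \<omega> \<longleftrightarrow> (\<forall>x. alternating_form s (\<omega> x)) \<and>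
    (\<forall>vs. (\<forall>x. (\<lambda>y. \<omega> y vs) differentiable (at x)) \<and>
      (\<forall>v. continuous_on UNIV (\<lambda>x. frechet_derivative (\<lambda>y. \<omega> y vs) (at x) v)))"

lemma alternating_swap:
  fixes \<alpha> :: "(real^'n::finite) list \<Rightarrow> real"
  assumes "alternating_form s \<alpha>" "length (xs @ a # b # ys) = s"
  shows "\<alpha> (xs @ a # b # ys) = - \<alpha> (xs @ b # a # ys)"
proof -
  let ?n = "length xs"
  have lin: "linear (\<lambda>v. \<alpha> (xs @ v # c # ys))" "linear (\<lambda>v. \<alpha> (xs @ c # v # ys))" for c
  proof -
    have l: "\<And>vs i. length vs = s \<Longrightarrow> i < s \<Longrightarrow> linear (\<lambda>v. \<alpha> (vs[i := v]))"
      using assms(1) by (auto simp: alternating_form_def)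
    show "linear (\<lambda>v. \<alpha> (xs @ v # c # ys))"
      using l[of "xs @ a # c # ys" ?n] assms(2) by simp
    show "linear (\<lambda>v. \<alpha> (xs @ c # v # ys))"
      using l[of "xs @ c # b # ys" "Suc ?n"] assms(2) by (simp add: list_update_append)
  qed
  have z: "\<alpha> (xs @ c # c # ys) = 0" for c
  proof -
    have "\<And>vs i j. length vs = s \<Longrightarrow> i < j \<Longrightarrow> j < s \<Longrightarrow> vs ! i = vs ! j \<Longrightarrow> \<alpha> vs = 0"
      using assms(1) by (auto simp: alternating_form_def)
    from this[of "xs @ c # c # ys" ?n "Suc ?n"] show ?thesis
      using assms(2) by (simp add: nth_append)
  qed
  have "\<alpha> (xs @ (a + b) # (a + b) # ys) = \<alpha> (xs @ a # a # ys) + \<alpha> (xs @ a # b # ys) +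
      (\<alpha> (xs @ b # a # ys) + \<alpha> (xs @ b # b # ys))"
    by (simp only: linear_add[OF lin(1)] linear_add[OF lin(2)])
  then show ?thesis by (simp only: z)
qed

lemma alternating_move:
  fixes \<alpha> :: "(real^'n::finite) list \<Rightarrow> real"
  assumes "alternating_form s \<alpha>" "length (us @ v # ws) = s"
  shows "\<alpha> (us @ v # ws) = (-1) ^ length us * \<alpha> (v # us @ ws)"
  using assms(2)
proof (induction us arbitrary: ws rule: rev_induct)
  case (snoc u us)
  have "\<alpha> ((us @ [u]) @ v # ws) = - \<alpha> (us @ v # u # ws)"
    using alternating_swap[OF assms(1), of us u v ws] snoc.prems by simp
  with snoc.IH[of "u # ws"] snoc.prems show ?case by simp
qed simp

lemma integral_directional_derivative:
  fixes f :: "real^'n::finite \<Rightarrow> real"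
  assumes diff: "\<And>x. f differentiable (at x)"
    and cont: "continuous_on UNIV (\<lambda>x. frechet_derivative f (at x) v)"
    and K: "compact K" "\<And>x. x \<notin> K \<Longrightarrow> f x = 0"
  shows "integrable lborel (\<lambda>x. frechet_derivative f (at x) v)"
    and "(LINT x|lborel. frechet_derivative f (at x) v) = 0"
proof -
  define g where "g x = frechet_derivative f (at x) v" for x
  have gc: "continuous_on S g" for S
    using cont continuous_on_subset unfolding g_def by blast
  have fd: "(f has_derivative frechet_derivative f (at x)) (at x)" for x
    using diff frechet_derivative_works by blast
  have fc: "continuous_on S f" for S
    by (meson continuous_at_imp_continuous_on diff differentiable_imp_continuous_within)
  have gK: "g x = 0" if "x \<notin> K" for x
  proof -
    have "open (- K)" using K(1) compact_imp_closed by blast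
    then have "((\<lambda>_. 0) has_derivative frechet_derivative f (at x)) (at x)"
      using has_derivative_transform_within_open[OF fd, of "- K" x "\<lambda>_. 0"] that K(2) by auto
    moreover have "((\<lambda>_. 0::real) has_derivative (\<lambda>_. 0)) (at x)" by simp
    ultimately have "frechet_derivative f (at x) = (\<lambda>_. 0)"
      by (rule has_derivative_unique)
    then show ?thesis by (simp add: g_def)
  qed
  have int: "integrable lborel h" if "continuous_on UNIV h" "\<And>x. x \<notin> K \<Longrightarrow> h x = 0"
    for h :: "real^'n \<Rightarrow> real"
  proof -
    have "integrable lborel (\<lambda>x. indicator K x *\<^sub>R h x)"
      using borel_integrable_compact[OF K(1)] that(1) continuous_on_subset
      unfolding set_integrable_def by blast
    moreover have "(\<lambda>x. indicator K x *\<^sub>R h x) = h"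
      using that(2) by (force simp: indicator_def)
    ultimately show ?thesis by simp
  qed
  have gi: "integrable lborel g" and fi: "integrable lborel f"
    using int gc gK fc K(2) by auto
  then show "integrable lborel (\<lambda>x. frechet_derivative f (at x) v)" by (simp add: g_def[abs_def])
  have shift: "(LINT x|lborel. h (x + a)) = (LINT x|lborel. h x)"
    if "h \<in> borel_measurable borel" for h :: "real^'n \<Rightarrow> real" and a
  proof -
    have "(LINT x|lborel. h x) = (LINT x|distr lborel borel ((+) a). h x)"
      using lborel_distr_plus[of a] by simp
    also have "\<dots> = (LINT x|lborel. h (a + x))"
      by (rule integral_distr) (use that in auto)
    finally show ?thesis by (simp add: add.commute)
  qed
  have gm [measurable]: "g \<in> borel_measurable borel" and fm [measurable]: "f \<in> borel_measurable borel"
    using gc fc borel_measurable_continuous_onI by blast+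
  have fsi: "integrable lborel (\<lambda>x. f (x + v))"
  proof -
    have "integrable (distr lborel borel ((+) v)) f"
      using fi lborel_distr_plus[of v] by simp
    then have "integrable lborel (\<lambda>x. f (v + x))"
      by (subst (asm) integrable_distr_eq) auto
    then show ?thesis by (simp add: add.commute)
  qed
  have ftc: "f (x + v) - f x = (LINT t|lborel. indicator {0..1} t *\<^sub>R g (x + t *\<^sub>R v))" for x
  proof -
    have d: "((\<lambda>t. f (x + t *\<^sub>R v)) has_vector_derivative g (x + t *\<^sub>R v)) (at t within {0..1})" for t
    proof -
      have "((\<lambda>t. x + t *\<^sub>R v) has_vector_derivative v) (at t within {0..1})"
        by (auto intro!: derivative_eq_intros)
      from has_derivative_at_withinI[OF fd] this show ?thesis
        unfolding g_def by (rule vector_derivative_diff_chain_within[rotated, unfolded o_def])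
    qed
    have "(LINT t|lborel. indicator {0..1} t *\<^sub>R g (x + t *\<^sub>R v)) = f (x + 1 *\<^sub>R v) - f (x + 0 *\<^sub>R v)"
      by (rule integral_FTC_atLeastAtMost)
         (auto intro!: d continuous_on_compose2[OF gc[of UNIV]] continuous_intros)
    then show ?thesis by simp
  qed
  define C where "C = (\<lambda>(k, t). (k - t *\<^sub>R v, t)) ` (K \<times> {0..1::real})"
  have C: "compact C"
    unfolding C_def by (rule compact_continuous_image)
      (auto intro!: continuous_intros compact_Times K simp: case_prod_beta)
  let ?G = "\<lambda>z. indicator {0..1} (snd z) *\<^sub>R g (fst z + snd z *\<^sub>R v)"
  have "?G = (\<lambda>z. indicator C z *\<^sub>R g (fst z + snd z *\<^sub>R v))"
  proof
    fix z :: "(real^'n) \<times> real"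
    show "?G z = indicator C z *\<^sub>R g (fst z + snd z *\<^sub>R v)"
    proof (cases "fst z + snd z *\<^sub>R v \<in> K")
      case True
      have "z \<in> C \<longleftrightarrow> snd z \<in> {0..1}"
      proof
        assume "snd z \<in> {0..1}"
        then show "z \<in> C" unfolding C_def using True
          by (intro image_eqI[of _ _ "(fst z + snd z *\<^sub>R v, snd z)"]) (auto simp: mem_Times_iff)
      qed (auto simp: C_def)
      then show ?thesis by (simp add: indicator_def)
    qed (simp add: gK)
  qed
  moreover have "continuous_on C (\<lambda>z. g (fst z + snd z *\<^sub>R v))"
    by (auto intro!: continuous_on_compose2[OF gc[of UNIV]] continuous_intros)
  then have "integrable lborel (\<lambda>z. indicator C z *\<^sub>R g (fst z + snd z *\<^sub>R v))"
    using borel_integrable_compact[OF C] unfolding set_integrable_def by blast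
  ultimately have "integrable (lborel \<Otimes>\<^sub>M lborel) ?G"
    by (simp add: lborel_prod)
  then have G: "integrable (lborel \<Otimes>\<^sub>M lborel)
      (\<lambda>(x, t). indicator {0..1} t *\<^sub>R g (x + t *\<^sub>R v))"
    by (simp only: case_prod_beta')
  have "0 = (LINT x|lborel. f (x + v) - f x)"
    using fi fsi by (simp add: Bochner_Integration.integral_diff shift)
  also have "\<dots> = (LINT x|lborel. LINT t|lborel. indicator {0..1} t *\<^sub>R g (x + t *\<^sub>R v))"
    by (simp only: ftc)
  also have "\<dots> = (LINT t|lborel. LINT x|lborel. indicator {0..1} t *\<^sub>R g (x + t *\<^sub>R v))"
    using lborel_pair.Fubini_integral[OF G] by simp
  also have "\<dots> = (LINT t|lborel. indicator {0..1::real} t *\<^sub>R (LINT x|lborel. g x))"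
    using shift[OF gm] by simp
  also have "\<dots> = (LINT x|lborel. g x)"
    by simp
  finally show "(LINT x|lborel. frechet_derivative f (at x) v) = 0"
    by (simp add: g_def[abs_def])
qed


lemma form_inner_dform:
  fixes \<omega> \<eta> :: "'n::finite form"
  assumes "alternating_form (Suc s) (\<eta> x)"
  shows "form_inner (Suc s) (dform \<omega> x) (\<eta> x) = (\<Sum>j\<in>UNIV. \<Sum>js | length js = s.
    frechet_derivative (\<lambda>y. \<omega> y (map (\<lambda>j. axis j 1) js)) (at x) (axis j 1) *
    \<eta> x (map (\<lambda>j. axis j 1) (j # js))) / fact s"
proof -
  let ?e = "\<lambda>j::'n. axis j (1::real)"
  let ?L = "\<lambda>n. {js::'n list. length js = n}"
  define F where "F j js = frechet_derivative (\<lambda>y. \<omega> y (map ?e js)) (at x) (?e j) *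
    \<eta> x (map ?e (j # js))" for j js
  have *: "(-1) ^ i * frechet_derivative (\<lambda>y. \<omega> y (take i (map ?e ks) @ drop (Suc i) (map ?e ks)))
      (at x) (?e (ks ! i)) * \<eta> x (map ?e ks) = F (ks ! i) (take i ks @ drop (Suc i) ks)"
    if "length ks = Suc s" "i < Suc s" for i ks
  proof -
    have "map ?e ks = map ?e (take i ks) @ ?e (ks ! i) # map ?e (drop (Suc i) ks)"
      using that by (metis id_take_nth_drop list.simps(9) map_append)
    then have "\<eta> x (map ?e ks) = (-1) ^ i * \<eta> x (map ?e (ks ! i # take i ks @ drop (Suc i) ks))"
      using alternating_move[OF assms, of "map ?e (take i ks)" "?e (ks ! i)" "map ?e (drop (Suc i) ks)"]
        that by simp
    moreover have "(-1) ^ i * (-1) ^ i = (1::real)"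
      by (simp flip: power_mult_distrib)
    ultimately show ?thesis
      using that by (simp add: F_def take_map drop_map)
  qed
  have "(\<Sum>ks\<in>?L (Suc s). dform \<omega> x (map ?e ks) * \<eta> x (map ?e ks))
      = (\<Sum>ks\<in>?L (Suc s). \<Sum>i<Suc s. F (ks ! i) (take i ks @ drop (Suc i) ks))"
    unfolding dform_def sum_distrib_right by (intro sum.cong refl) (auto intro!: sum.cong *)
  also have "\<dots> = (\<Sum>i<Suc s. \<Sum>ks\<in>?L (Suc s). F (ks ! i) (take i ks @ drop (Suc i) ks))"
    by (rule sum.swap)
  also have "\<dots> = (\<Sum>i<Suc s. \<Sum>(j, js)\<in>UNIV \<times> ?L s. F j js)"
  proof (intro sum.cong refl)
    fix i assume "i \<in> {..<Suc s}"
    then show "(\<Sum>ks\<in>?L (Suc s). F (ks ! i) (take i ks @ drop (Suc i) ks))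
        = (\<Sum>(j, js)\<in>UNIV \<times> ?L s. F j js)"
      by (intro sum.reindex_bij_witness[of _ "\<lambda>(j, js). take i js @ j # drop i js"
            "\<lambda>ks. (ks ! i, take i ks @ drop (Suc i) ks)"])
         (auto simp: nth_append min_def id_take_nth_drop[symmetric])
  qed
  also have "\<dots> = real (Suc s) * (\<Sum>j\<in>UNIV. \<Sum>js\<in>?L s. F j js)"
    by (simp add: sum.cartesian_product)
  finally show ?thesis
    unfolding form_inner_def F_def by (simp add: divide_simps del: of_nat_Suc)
qed

lemma codiff_formal_adjoint:
  fixes \<omega> \<eta> :: "'n::finite form"
  assumes \<omega>: "C1_form s \<omega>" and \<eta>: "C1_form (Suc s) \<eta>"
    and K: "compact K" "\<And>x. x \<notin> K \<Longrightarrow> \<omega> x = 0"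
  shows "(LINT x|lborel. form_inner (Suc s) (dform \<omega> x) (\<eta> x)) =
    (LINT x|lborel. form_inner s (\<omega> x) (codiff \<eta> x))"
proof -
  let ?e = "\<lambda>j::'n. axis j (1::real)"
  let ?L = "{js::'n list. length js = s}"
  let ?D = "\<lambda>f x v. frechet_derivative f (at x) v"
  have finL: "finite ?L"
    using finite_lists_length_eq[of "UNIV :: 'n set" s] by simp
  have d: "(\<lambda>y. \<omega> y vs) differentiable (at x)" "(\<lambda>y. \<eta> y vs) differentiable (at x)" for vs x
    using \<omega> \<eta> by (auto simp: C1_form_def)
  have c: "continuous_on UNIV (\<lambda>x. \<omega> x vs)" "continuous_on UNIV (\<lambda>x. \<eta> x vs)" for vs
    using d by (meson continuous_at_imp_continuous_on differentiable_imp_continuous_within)+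
  have dc: "continuous_on UNIV (\<lambda>x. ?D (\<lambda>y. \<omega> y vs) x v)"
    "continuous_on UNIV (\<lambda>x. ?D (\<lambda>y. \<eta> y vs) x v)" for vs v
    using \<omega> \<eta> by (auto simp: C1_form_def)
  define f where "f j js y = \<omega> y (map ?e js) * \<eta> y (map ?e (j # js))" for j js y
  define B where "B j js x = \<omega> x (map ?e js) * ?D (\<lambda>y. \<eta> y (map ?e (j # js))) x (?e j)" for j js x
  have fD: "f j js differentiable (at x)" for j js x
    unfolding f_def by (intro differentiable_mult d)
  have df: "?D (f j js) x v = \<omega> x (map ?e js) * ?D (\<lambda>y. \<eta> y (map ?e (j # js))) x v +
      ?D (\<lambda>y. \<omega> y (map ?e js)) x v * \<eta> x (map ?e (j # js))" for j js x v
  proof -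
    have "(f j js has_derivative (\<lambda>v. \<omega> x (map ?e js) * ?D (\<lambda>y. \<eta> y (map ?e (j # js))) x v +
      ?D (\<lambda>y. \<omega> y (map ?e js)) x v * \<eta> x (map ?e (j # js)))) (at x)"
      unfolding f_def by (intro has_derivative_mult d[THEN frechet_derivative_works[THEN iffD1]])
    from fun_cong[OF frechet_derivative_at[OF this], of v] show ?thesis by (rule sym)
  qed
  have dfc: "continuous_on UNIV (\<lambda>x. ?D (f j js) x v)" for j js v
    unfolding df by (intro continuous_on_add continuous_on_mult c dc)
  have f0: "x \<notin> K \<Longrightarrow> f j js x = 0" for j js x
    by (simp add: f_def K)
  note df_int = integral_directional_derivative[OF fD dfc K(1) f0]
  have B_int: "integrable lborel (B j js)" for j js
  proof -
    have "continuous_on K (B j js)"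
      unfolding B_def by (rule continuous_on_subset[OF _ subset_UNIV]) (intro continuous_on_mult c dc)
    then have "integrable lborel (\<lambda>x. indicator K x *\<^sub>R B j js x)"
      using borel_integrable_compact[OF K(1)] unfolding set_integrable_def by blast
    moreover have "(\<lambda>x. indicator K x *\<^sub>R B j js x) = B j js"
      using K(2) by (force simp: indicator_def B_def)
    ultimately show ?thesis by simp
  qed
  have 1: "form_inner s (\<omega> x) (codiff \<eta> x) = - (\<Sum>j\<in>UNIV. \<Sum>js\<in>?L. B j js x) / fact s" for x
    unfolding form_inner_def codiff_def B_def
    by (subst sum.swap) (simp add: sum_distrib_left sum_negf)
  have 2: "form_inner (Suc s) (dform \<omega> x) (\<eta> x) =
      (\<Sum>j\<in>UNIV. \<Sum>js\<in>?L. ?D (f j js) x (?e j) - B j js x) / fact s" for x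
    using \<eta> by (subst form_inner_dform) (simp_all add: C1_form_def df B_def)
  have DB_int: "integrable lborel (\<lambda>x. ?D (f j js) x (?e j) - B j js x)" for j js
    by (intro Bochner_Integration.integrable_diff df_int(1) B_int)
  have DB: "(LINT x|lborel. ?D (f j js) x (?e j) - B j js x) = - (LINT x|lborel. B j js x)" for j js
    by (subst Bochner_Integration.integral_diff[OF df_int(1) B_int]) (simp_all add: df_int(2))
  have "(LINT x|lborel. (\<Sum>j\<in>UNIV. \<Sum>js\<in>?L. ?D (f j js) x (?e j) - B j js x)) =
      (\<Sum>j\<in>UNIV. \<Sum>js\<in>?L. (LINT x|lborel. ?D (f j js) x (?e j) - B j js x))"
    by (simp only: Bochner_Integration.integral_sum Bochner_Integration.integrable_sum DB_int)
  also have "\<dots> = - (\<Sum>j\<in>UNIV. \<Sum>js\<in>?L. (LINT x|lborel. B j js x))"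
    by (simp only: DB sum_negf)
  also have "\<dots> = - (LINT x|lborel. (\<Sum>j\<in>UNIV. \<Sum>js\<in>?L. B j js x))"
    by (simp only: Bochner_Integration.integral_sum Bochner_Integration.integrable_sum B_int)
  finally show ?thesis
    unfolding 1 2 by simp
qed

section \<open>Modules over the orthogonal group\<close>

text \<open>Elements of \<open>O(m)\<close> are orthogonal transformations, acting on forms by pullback along
  the inverse.\<close>

definition form_act :: "(real^'n \<Rightarrow> real^'n) \<Rightarrow> 'n::finite form \<Rightarrow> 'n form"
  where "form_act g \<omega> = (\<lambda>x vs. \<omega> (inv g x) (map (inv g) vs))"

definition submodule :: "'n::finite form set \<Rightarrow> bool"
  where "submodule S \<longleftrightarrow> subspace S \<and>
    (\<forall>g. orthogonal_transformation g \<longrightarrow> (\<forall>\<omega>\<in>S. form_act g \<omega> \<in> S))"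

definition irreducible_module :: "'n::finite form set \<Rightarrow> bool"
  where "irreducible_module S \<longleftrightarrow> submodule S \<and> S \<noteq> {0} \<and>
    (\<forall>T. submodule T \<longrightarrow> T \<subseteq> S \<longrightarrow> T = {0} \<or> T = S)"

text \<open>
  Quotients have sets of forms as elements, hence the general structure with explicit operations.
\<close>

record ('v, 'g) omodule =
  mcarrier :: "'v set"
  madd :: "'v \<Rightarrow> 'v \<Rightarrow> 'v"
  mscale :: "real \<Rightarrow> 'v \<Rightarrow> 'v"
  mact :: "'g \<Rightarrow> 'v \<Rightarrow> 'v"

definition omodule_iso ::
    "('v, real^'n \<Rightarrow> real^'n) omodule \<Rightarrow> ('w, real^'n \<Rightarrow> real^'n) omodule \<Rightarrow> bool"
    (infix "\<simeq>\<^sub>O" 50)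
  where "M \<simeq>\<^sub>O N \<longleftrightarrow> (\<exists>f. bij_betw f (mcarrier M) (mcarrier N) \<and>
    (\<forall>x\<in>mcarrier M. \<forall>y\<in>mcarrier M. f (madd M x y) = madd N (f x) (f y)) \<and>
    (\<forall>c. \<forall>x\<in>mcarrier M. f (mscale M c x) = mscale N c (f x)) \<and>
    (\<forall>g. orthogonal_transformation g \<longrightarrow> (\<forall>x\<in>mcarrier M. f (mact M g x) = mact N g (f x))))"

definition form_module :: "'n::finite form set \<Rightarrow> ('n form, real^'n \<Rightarrow> real^'n) omodule"
  where "form_module S =
    \<lparr>mcarrier = S, madd = (+), mscale = (*\<^sub>R), mact = form_act\<rparr>"

definition quotient_module ::
    "'n::finite form set \<Rightarrow> 'n form set \<Rightarrow> ('n form set, real^'n \<Rightarrow> real^'n) omodule"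
    (infixl "'/\<^sub>O" 70)
  where "A /\<^sub>O B =
    \<lparr>mcarrier = A // {(\<omega>, \<eta>). \<omega> \<in> A \<and> \<eta> \<in> A \<and> \<omega> - \<eta> \<in> B},
     madd = (\<lambda>X Y. {\<omega> + \<eta> |\<omega> \<eta>. \<omega> \<in> X \<and> \<eta> \<in> Y}),
     mscale = (\<lambda>c X. {c *\<^sub>R \<omega> + \<beta> |\<omega> \<beta>. \<omega> \<in> X \<and> \<beta> \<in> B}),
     mact = (\<lambda>g X. form_act g ` X)\<rparr>"

definition is_direct_sum :: "'a::comm_monoid_add set \<Rightarrow> 'a set list \<Rightarrow> bool"
  where "is_direct_sum K Ss \<longleftrightarrow>
    K = {sum_list xs |xs. list_all2 (\<in>) xs Ss} \<and>
    (\<forall>xs ys. list_all2 (\<in>) xs Ss \<longrightarrow> list_all2 (\<in>) ys Ss \<longrightarrow>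
      sum_list xs = sum_list ys \<longrightarrow> xs = ys)"

text \<open>
  The defining properties of the decomposition \<open>Ker\<^sup>s\<^sub>k \<Delta> = H\<^sup>s\<^sub>k \<oplus> U \<oplus> V \<oplus> W\<close>.
  The second and third conditions are what make \<open>U\<close>, \<open>V\<close>, \<open>W\<close> unique.
\<close>

definition harmonic_decomposition ::
    "nat \<Rightarrow> nat \<Rightarrow> 'n::finite form set \<Rightarrow> 'n form set \<Rightarrow> 'n form set \<Rightarrow> bool"
  where "harmonic_decomposition s k U V W \<longleftrightarrow>
    (\<forall>X\<in>{Hspace s k, U, V, W}. submodule X) \<and>
    (\<forall>X\<in>{Hspace s k, U, V, W}. X = {0} \<or> irreducible_module X) \<and>
    sorted_wrt (\<lambda>X Y. X \<noteq> {0} \<and> Y \<noteq> {0} \<longrightarrow> \<not> form_module X \<simeq>\<^sub>O form_module Y)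
      [Hspace s k, U, V, W] \<and>
    is_direct_sum (Ker s k hodge_laplacian) [Hspace s k, U, V, W] \<and>
    (if 1 \<le> s \<and> 1 \<le> k
     then form_module U \<simeq>\<^sub>O form_module (Hspace (s - 1) (k - 1) :: 'n form set)
     else U = {0}) \<and>
    (if s < CARD('n) \<and> 1 \<le> k
     then form_module V \<simeq>\<^sub>O form_module (Hspace (s + 1) (k - 1) :: 'n form set)
     else V = {0}) \<and>
    (if 1 \<le> s \<and> s < CARD('n) \<and> 2 \<le> k
     then form_module W \<simeq>\<^sub>O form_module (Hspace s (k - 2) :: 'n form set)
     else W = {0})"

end

theory Submission
  imports Defs
begin

text \<open>
  Write \<open>\<iota>\<close> for the interior product with the radial field \<open>x\<close> and \<open>\<epsilon>\<close> for the exterior product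
  with its dual one-form. On \<open>P\<^sup>s\<^sub>k\<close> one has \<open>d\<iota> + \<iota>d = k + s\<close>, \<open>d\<^sup>*\<epsilon> + \<epsilon>d\<^sup>* = -(k + m - s)\<close>,
  \<open>d\<epsilon> + \<epsilon>d = 0\<close> and \<open>d\<^sup>*\<iota> + \<iota>d\<^sup>* = 0\<close>. Hence up to nonzero factors \<open>\<epsilon>\<eta>\<close>, \<open>\<iota>\<eta>\<close> and a combination of
  \<open>\<epsilon>\<iota>\<eta>\<close> and \<open>\<iota>\<epsilon>\<eta>\<close> are preimages of a closed and coclosed \<open>\<eta>\<close> under \<open>d\<^sup>*\<close>, \<open>d\<close> and \<open>dd\<^sup>*\<close>, so
  that \<open>d\<^sup>*\<close> maps \<open>Ker dd\<^sup>*\<close> onto \<open>H\<^sup>s\<^sup>-\<^sup>1\<^sub>k\<^sub>-\<^sub>1\<close>, \<open>d\<close> maps \<open>Ker d\<^sup>*d\<close> onto \<open>H\<^sup>s\<^sup>+\<^sup>1\<^sub>k\<^sub>-\<^sub>1\<close>, and \<open>dd\<^sup>*\<close> maps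
  \<open>Ker \<Delta>\<close> onto \<open>H\<^sup>s\<^sub>k\<^sub>-\<^sub>2\<close>. This gives the quotients in (a) and (b). By Schur's lemma each of these three
  maps kills every summand of \<open>Ker \<Delta>\<close> (in its domain) except the one isomorphic to its image, on
  which it is injective; comparing kernels gives (c) and (d).
\<close>

section \<open>Directional derivatives of polynomial functions\<close>

abbreviation dird :: "'a::real_normed_vector \<Rightarrow> ('a \<Rightarrow> real) \<Rightarrow> 'a \<Rightarrow> real"
  where "dird v f x \<equiv> frechet_derivative f (at x) v"

lemma dird_eqI: "(f has_derivative f') (at x) \<Longrightarrow> dird v f x = f' v"
  using frechet_derivative_at by metis

lemma dird_has_derivative:
  "real_polynomial_function p \<Longrightarrow> (p has_derivative (\<lambda>v. dird v p x)) (at x)"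
  using differentiable_at_real_polynomial_function frechet_derivative_works by blast

lemma dird_bounded_linear: "bounded_linear f \<Longrightarrow> dird v f x = f v"
  by (simp add: bounded_linear_imp_has_derivative dird_eqI)

lemma dird_const [simp]: "dird v (\<lambda>x. c) x = 0"
  by (simp add: frechet_derivative_const)

lemma dird_add:
  "real_polynomial_function p \<Longrightarrow> real_polynomial_function q \<Longrightarrow>
    dird v (\<lambda>x. p x + q x) x = dird v p x + dird v q x"
  by (rule dird_eqI) (intro has_derivative_add dird_has_derivative)

lemma dird_diff:
  "real_polynomial_function p \<Longrightarrow> real_polynomial_function q \<Longrightarrow>
    dird v (\<lambda>x. p x - q x) x = dird v p x - dird v q x"
  by (rule dird_eqI) (intro has_derivative_diff dird_has_derivative)

lemma dird_minus:
  "real_polynomial_function p \<Longrightarrow> dird v (\<lambda>x. - p x) x = - dird v p x"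
  by (rule dird_eqI) (intro has_derivative_minus dird_has_derivative)

lemma dird_mult:
  "real_polynomial_function p \<Longrightarrow> real_polynomial_function q \<Longrightarrow>
    dird v (\<lambda>x. p x * q x) x = p x * dird v q x + dird v p x * q x"
  by (rule dird_eqI) (intro has_derivative_mult dird_has_derivative)

lemma dird_cmult:
  "real_polynomial_function p \<Longrightarrow> dird v (\<lambda>x. c * p x) x = c * dird v p x"
  by (simp add: dird_mult real_polynomial_function.intros)

lemma dird_sum:
  "(\<And>i. i \<in> I \<Longrightarrow> real_polynomial_function (p i)) \<Longrightarrow>
    dird v (\<lambda>x. \<Sum>i\<in>I. p i x) x = (\<Sum>i\<in>I. dird v (p i) x)"
  by (rule dird_eqI) (intro has_derivative_sum dird_has_derivative)

lemma linear_dird: "real_polynomial_function p \<Longrightarrow> linear (\<lambda>v. dird v p x)"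
  using dird_has_derivative has_derivative_linear by blast

lemma real_polynomial_function_dird:
  "real_polynomial_function p \<Longrightarrow> real_polynomial_function (dird v p)"
proof (induction p rule: real_polynomial_function.induct)
  case (linear f)
  then have "dird v f = (\<lambda>x. f v)" by (simp add: dird_bounded_linear fun_eq_iff)
  then show ?case by auto
next
  case (const c)
  then show ?case by (simp add: real_polynomial_function.intros)
next
  case (add f g)
  then have "dird v (\<lambda>x. f x + g x) = (\<lambda>x. dird v f x + dird v g x)"
    by (simp add: dird_add fun_eq_iff)
  with add show ?case by auto
next
  case (mult f g)
  then have "dird v (\<lambda>x. f x * g x) = (\<lambda>x. f x * dird v g x + dird v f x * g x)"
    by (simp add: dird_mult fun_eq_iff)
  with mult show ?case by auto
qed

lemma dird_commute:
  "real_polynomial_function p \<Longrightarrow> dird v (dird w p) x = dird w (dird v p) x"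
proof (induction p arbitrary: x rule: real_polynomial_function.induct)
  case (linear f)
  then have "dird v f = (\<lambda>x. f v)" "dird w f = (\<lambda>x. f w)"
    by (simp_all add: dird_bounded_linear fun_eq_iff)
  then show ?case by simp
next
  case (const c)
  then show ?case by simp
next
  case (add f g)
  then have "dird v (\<lambda>x. f x + g x) = (\<lambda>x. dird v f x + dird v g x)" for v
    by (simp add: dird_add fun_eq_iff)
  with add show ?case by (simp add: dird_add real_polynomial_function_dird)
next
  case (mult f g)
  then have "dird v (\<lambda>x. f x * g x) = (\<lambda>x. f x * dird v g x + dird v f x * g x)" for v
    by (simp add: dird_mult fun_eq_iff)
  with mult show ?case
    by (simp add: dird_mult dird_add real_polynomial_function_dird real_polynomial_function.intros)
qed

lemma dird_comp_linear:
  assumes "real_polynomial_function p" and "bounded_linear h"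
  shows "dird v (\<lambda>x. p (h x)) x = dird (h v) p (h x)"
proof (rule dird_eqI)
  show "((\<lambda>x. p (h x)) has_derivative (\<lambda>v. dird (h v) p (h x))) (at x)"
    using has_derivative_compose[OF bounded_linear_imp_has_derivative[OF assms(2)]
        dird_has_derivative[OF assms(1)]] by simp
qed

text \<open>The chain rule applied to the homogeneity equation yields the claim multiplied by
  \<open>c\<close>. Cancelling settles \<open>c \<noteq> 0\<close>, and continuity in
  \<open>c\<close> the value 0.\<close>

lemma homogeneous_polynomial_dird:
  assumes "homogeneous_polynomial (Suc k) p"
  shows "homogeneous_polynomial k (dird v p)"
proof -
  have p: "real_polynomial_function p" and hom: "\<And>c x. p (c *\<^sub>R x) = c ^ Suc k * p x"
    using assms by (auto simp: homogeneous_polynomial_def)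
  note p' = real_polynomial_function_dird[OF p, of v]
  have eq: "dird v p (c *\<^sub>R x) = c ^ k * dird v p x" if "c \<noteq> 0" for c x
  proof -
    have "c * dird v p (c *\<^sub>R x) = dird (c *\<^sub>R v) p (c *\<^sub>R x)"
      using linear_cmul[OF linear_dird[OF p]] by simp
    also have "\<dots> = dird v (\<lambda>x. p (c *\<^sub>R x)) x"
      using dird_comp_linear[OF p, of "\<lambda>x. c *\<^sub>R x"] by (simp add: bounded_linear_scaleR_right)
    also have "\<dots> = c * (c ^ k * dird v p x)"
      by (simp add: hom dird_cmult[OF p])
    finally show ?thesis using that by simp
  qed
  have "dird v p (c *\<^sub>R x) = c ^ k * dird v p x" for c x
  proof -
    have cl: "closed {c. dird v p (c *\<^sub>R x) = c ^ k * dird v p x}"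
    proof (rule closed_Collect_eq)
      have "continuous_on UNIV (dird v p)"
        using p' by (simp add: continuous_on_polymonial_function real_polynomial_function_eq)
      then show "continuous_on UNIV (\<lambda>c. dird v p (c *\<^sub>R x))"
        by (rule continuous_on_compose2) (auto intro!: continuous_intros)
    qed (auto intro!: continuous_intros)
    \<comment> \<open>The set of good scalars is closed and contains the dense set of nonzero
      reals.\<close>
    have "closure (- {0}) \<subseteq> {c. dird v p (c *\<^sub>R x) = c ^ k * dird v p x}"
      by (rule closure_minimal[OF _ cl]) (use eq in auto)
    moreover have "closure (- {0::real}) = UNIV"
      by (simp add: closure_complement)
    ultimately show ?thesis by auto
  qed
  with p' show ?thesis by (auto simp: homogeneous_polynomial_def)
qed

lemma homogeneous_polynomial_0_dird:
  assumes "homogeneous_polynomial 0 p"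
  shows "dird v p x = 0"
proof -
  \<comment> \<open>Homogeneity with scalar 0, where \<open>0 ^ 0 = 1\<close>.\<close>
  have "p x = p 0" for x
    using assms[unfolded homogeneous_polynomial_def, THEN conjunct2, rule_format, of 0 x] by simp
  then have "p = (\<lambda>x. p 0)" by (simp add: fun_eq_iff)
  then show ?thesis by (metis dird_const)
qed

text \<open>Euler's identity: \<open>p\<close> along the ray through \<open>x\<close> is
  differentiated at parameter 1 by the chain rule and as a power of the parameter.\<close>

lemma homogeneous_polynomial_euler:
  assumes "homogeneous_polynomial k p"
  shows "dird x p x = real k * p x"
proof -
  have p: "real_polynomial_function p" and hom: "\<And>c x. p (c *\<^sub>R x) = c ^ k * p x"
    using assms by (auto simp: homogeneous_polynomial_def)
  have "((\<lambda>c. p (c *\<^sub>R x)) has_derivative (\<lambda>t. dird (t *\<^sub>R x) p (1 *\<^sub>R x))) (at 1)"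
    by (rule has_derivative_compose[of "\<lambda>c. c *\<^sub>R x", OF _ dird_has_derivative[OF p]])
       (auto intro!: derivative_eq_intros)
  moreover have "((\<lambda>c. p (c *\<^sub>R x)) has_derivative (\<lambda>t. t * (real k * p x))) (at 1)"
    unfolding hom by (auto intro!: derivative_eq_intros)
  ultimately have "(\<lambda>t. dird (t *\<^sub>R x) p (1 *\<^sub>R x)) = (\<lambda>t. t * (real k * p x))"
    by (rule has_derivative_unique)
  from fun_cong[OF this, of 1] show ?thesis by simp
qed

lemma linear_axis_expansion:
  fixes f :: "real^'n::finite \<Rightarrow> real"
  assumes "linear f"
  shows "(\<Sum>j\<in>UNIV. v $ j * f (axis j 1)) = f v"
proof -
  have "f (\<Sum>j\<in>UNIV. (v $ j) *\<^sub>R axis j 1) = (\<Sum>j\<in>UNIV. v $ j * f (axis j 1))"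
    by (simp add: linear_sum[OF assms] linear_cmul[OF assms])
  then show ?thesis
    using basis_expansion[of v] by (simp add: scalar_mult_eq_scaleR)
qed

section \<open>Alternating forms\<close>

lemma linear_const_zero [simp]: "linear (\<lambda>v. 0)"
  by (simp add: linear_iff)

lemma linear_cmult: "linear f \<Longrightarrow> linear (\<lambda>v. c * f v)" for c :: real
  using linear_compose_scale_right[of f c] by simp

lemma alternating_form_length: "alternating_form s \<alpha> \<Longrightarrow> length vs \<noteq> s \<Longrightarrow> \<alpha> vs = 0"
  by (simp add: alternating_form_def)

lemma alternating_form_linear:
  assumes "alternating_form s \<alpha>"
  shows "linear (\<lambda>v. \<alpha> (us @ v # vs))"
proof (cases "length (us @ undefined # vs) = s")
  case True
  \<comment> \<open>The entry \<open>undefined\<close> is a placeholder at position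
    \<open>length us\<close> that the list update overwrites.\<close>
  with assms have "linear (\<lambda>v. \<alpha> ((us @ undefined # vs)[length us := v]))"
    unfolding alternating_form_def by (metis length_append length_Cons less_add_Suc1 add_Suc_right)
  then show ?thesis by simp
next
  case False
  with assms have "(\<lambda>v. \<alpha> (us @ v # vs)) = (\<lambda>v. 0)"
    by (auto simp: alternating_form_def fun_eq_iff)
  then show ?thesis by simp
qed

lemma alternating_form_linear_Cons: "alternating_form s \<alpha> \<Longrightarrow> linear (\<lambda>v. \<alpha> (v # vs))"
  using alternating_form_linear[of s \<alpha> "[]"] by simp

lemma alternating_form_Cons_swap:
  assumes "alternating_form s \<alpha>"
  shows "\<alpha> (a # b # vs) = - \<alpha> (b # a # vs)"
proof (cases "length (a # b # vs) = s")
  case True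
  then show ?thesis using alternating_swap[OF assms, of "[]" a b vs] by simp
next
  case False
  then show ?thesis using assms by (simp add: alternating_form_length)
qed

lemma alternating_form_repeat:
  assumes "alternating_form s \<alpha>" "i < j" "j < length vs" "vs ! i = vs ! j"
  shows "\<alpha> vs = 0"
  using assms unfolding alternating_form_def by (metis)

lemma alternating_form_zero [simp]: "alternating_form s (\<lambda>vs. 0)"
  by (simp add: alternating_form_def)

lemma alternating_form_add:
  "alternating_form s \<alpha> \<Longrightarrow> alternating_form s \<beta> \<Longrightarrow> alternating_form s (\<lambda>vs. \<alpha> vs + \<beta> vs)"
  by (auto simp: alternating_form_def intro: linear_compose_add)

lemma alternating_form_cmult:
  "alternating_form s \<alpha> \<Longrightarrow> alternating_form s (\<lambda>vs. c * \<alpha> vs)"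
  by (auto simp: alternating_form_def intro: linear_cmult)

lemma alternating_form_minus:
  "alternating_form s \<alpha> \<Longrightarrow> alternating_form s (\<lambda>vs. - \<alpha> vs)"
  using alternating_form_cmult[of s \<alpha> "-1"] by simp

lemma alternating_form_sum:
  "(\<And>i. i \<in> I \<Longrightarrow> alternating_form s (\<alpha> i)) \<Longrightarrow> alternating_form s (\<lambda>vs. \<Sum>i\<in>I. \<alpha> i vs)"
  by (induction I rule: infinite_finite_induct) (auto intro: alternating_form_add)

lemma alternating_form_contract:
  assumes "alternating_form (Suc s) \<alpha>"
  shows "alternating_form s (\<lambda>vs. \<alpha> (v # vs))"
  unfolding alternating_form_def
proof (intro conjI allI impI)
  fix vs :: "(real^'a) list" and i assume "length vs = s" "i < s"
  then have "linear (\<lambda>u. \<alpha> ((v # vs)[Suc i := u]))"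
    using assms unfolding alternating_form_def by (metis Suc_mono length_Cons)
  then show "linear (\<lambda>u. \<alpha> (v # vs[i := u]))" by simp
next
  fix vs :: "(real^'a) list" and i j
  assume "length vs = s" "i < j" "j < s" "vs ! i = vs ! j"
  then show "\<alpha> (v # vs) = 0"
    using alternating_form_repeat[OF assms, of "Suc i" "Suc j" "v # vs"] by simp
qed (use assms in \<open>auto simp: alternating_form_def\<close>)

text \<open>Introduction rule matching recursion on the argument list: a repetition of the front
  argument further along can be moved to the second place at the cost of a sign, so only repetitions
  in the first two places need checking.\<close>

lemma alternating_form_SucI:
  fixes \<alpha> :: "(real^'n::finite) list \<Rightarrow> real"
  assumes nil: "\<alpha> [] = 0"
    and alt: "\<And>v. alternating_form s (\<lambda>vs. \<alpha> (v # vs))"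
    and lin: "\<And>vs. linear (\<lambda>v. \<alpha> (v # vs))"
    and rep: "\<And>v vs. \<alpha> (v # v # vs) = 0"
  shows "alternating_form (Suc s) \<alpha>"
  unfolding alternating_form_def
proof (intro conjI allI impI)
  fix vs :: "(real^'n) list" assume "length vs \<noteq> Suc s"
  then show "\<alpha> vs = 0" using nil alternating_form_length[OF alt] by (cases vs) auto
next
  fix vs :: "(real^'n) list" and i assume *: "length vs = Suc s" "i < Suc s"
  then obtain u us where vs: "vs = u # us" by (cases vs) auto
  show "linear (\<lambda>v. \<alpha> (vs[i := v]))"
  proof (cases i)
    case 0
    then show ?thesis using lin vs by simp
  next
    case (Suc l)
    with * vs alt[of u] show ?thesis by (simp add: alternating_form_def)
  qed
next
  fix vs :: "(real^'n) list" and i j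
  assume *: "length vs = Suc s" "i < j" "j < Suc s" "vs ! i = vs ! j"
  then obtain u us where vs: "vs = u # us" by (cases vs) auto
  show "\<alpha> vs = 0"
  proof (cases i)
    case 0
    with * vs obtain l where l: "l < length us" "us ! l = u" by (cases j) auto
    then have us: "us = take l us @ u # drop (Suc l) us" by (metis id_take_nth_drop)
    \<comment> \<open>The second copy of \<open>u\<close> moves next to the first, inside the
      alternating form with front argument \<open>u\<close> fixed.\<close>
    have "\<alpha> (u # take l us @ u # drop (Suc l) us)
        = (-1) ^ length (take l us) * \<alpha> (u # u # take l us @ drop (Suc l) us)"
      using alternating_move[OF alt, of "take l us" u "drop (Suc l) us" u] us * vs by simp
    then show ?thesis using us vs rep by simp
  next
    case (Suc l)
    with * vs show ?thesis using alternating_form_repeat[OF alt[of u], of l "j - 1" us] by (cases j) auto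
  qed
qed

text \<open>Multilinearity reduces to basis vectors, and more than \<open>CARD('n)\<close> of those
  must repeat.\<close>

lemma alternating_form_eq_0_of_card_less:
  fixes \<alpha> :: "(real^'n::finite) list \<Rightarrow> real"
  assumes \<alpha>: "alternating_form s \<alpha>" and s: "CARD('n) < s"
  shows "\<alpha> vs = 0"
proof -
  \<comment> \<open>The prefix \<open>js\<close> collects the arguments already expanded in the
    basis, so the induction replaces them one at a time.\<close>
  have "\<alpha> (map (\<lambda>j. axis j 1) js @ vs) = 0" for js :: "'n list"
  proof (induction vs arbitrary: js)
    case Nil
    show ?case
    proof (cases "length js = s")
      case True
      have "\<not> distinct js"
        using card_mono[of "UNIV :: 'n set" "set js"] distinct_card[of js] True s by auto
      then obtain i j where "i < j" "j < length js" "js ! i = js ! j"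
        by (metis distinct_conv_nth linorder_neqE_nat)
      then show ?thesis
        using alternating_form_repeat[OF \<alpha>, of i j "map (\<lambda>j. axis j 1) js"] by simp
    qed (simp add: alternating_form_length[OF \<alpha>])
  next
    case (Cons v vs)
    have "\<alpha> (map (\<lambda>j. axis j 1) js @ axis j 1 # vs) = 0" for j
      using Cons.IH[of "js @ [j]"] by simp
    then show ?case
      using linear_axis_expansion[OF alternating_form_linear[OF \<alpha>], of v "map (\<lambda>j. axis j 1) js" vs]
      by simp
  qed
  from this[of "[]"] show ?thesis by simp
qed

section \<open>Antisymmetrised products\<close>

text \<open>Common shape of the differential (\<open>L u\<close> a derivative in direction
  \<open>u\<close>) and of the exterior product with a one-form (\<open>L u\<close> a form times the
  value of the one-form on \<open>u\<close>).\<close>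

definition ext_prod :: "('v \<Rightarrow> 'v list \<Rightarrow> real) \<Rightarrow> 'v list \<Rightarrow> real"
  where "ext_prod L vs = (\<Sum>i<length vs. (-1) ^ i * L (vs ! i) (take i vs @ drop (Suc i) vs))"

lemma ext_prod_Nil [simp]: "ext_prod L [] = 0"
  by (simp add: ext_prod_def)

text \<open>The antiderivation rule for contraction with \<open>v\<close>, the recursion behind the
  later inductions on the argument list.\<close>

lemma ext_prod_Cons: "ext_prod L (v # vs) = L v vs - ext_prod (\<lambda>u us. L u (v # us)) vs"
  by (simp add: ext_prod_def sum.lessThan_Suc_shift sum_negf del: sum.lessThan_Suc)

lemma ext_prod_zero [simp]: "ext_prod (\<lambda>u us. 0) vs = 0"
  by (simp add: ext_prod_def)

lemma ext_prod_add: "ext_prod (\<lambda>u us. L u us + M u us) vs = ext_prod L vs + ext_prod M vs"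
  by (simp add: ext_prod_def sum.distrib algebra_simps)

lemma ext_prod_minus: "ext_prod (\<lambda>u us. - L u us) vs = - ext_prod L vs"
  by (simp add: ext_prod_def sum_negf)

lemma ext_prod_diff: "ext_prod (\<lambda>u us. L u us - M u us) vs = ext_prod L vs - ext_prod M vs"
  by (simp add: ext_prod_def sum_subtractf algebra_simps)

lemma ext_prod_cmult: "ext_prod (\<lambda>u us. c * L u us) vs = c * ext_prod L vs"
  by (simp add: ext_prod_def sum_distrib_left algebra_simps)

lemma ext_prod_sum: "ext_prod (\<lambda>u us. \<Sum>i\<in>I. L i u us) vs = (\<Sum>i\<in>I. ext_prod (L i) vs)"
  unfolding ext_prod_def sum_distrib_left by (rule sum.swap)

lemma ext_prod_linear:
  assumes "\<And>u us. linear (\<lambda>v. L v u us)"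
  shows "linear (\<lambda>v. ext_prod (L v) vs)"
  unfolding ext_prod_def
  by (intro linear_compose_sum ballI linear_cmult assms)

text \<open>Induction on the degree: contraction with \<open>v\<close> gives \<open>L v\<close>
  minus the product of the contracted family, whose degree is one lower.\<close>

lemma alternating_form_ext_prod:
  fixes L :: "real^'n::finite \<Rightarrow> (real^'n) list \<Rightarrow> real"
  assumes "\<And>v. alternating_form s (L v)" and "\<And>vs. linear (\<lambda>v. L v vs)"
  shows "alternating_form (Suc s) (ext_prod L)"
  using assms
proof (induction s arbitrary: L)
  case IH: (Suc s)
  show ?case
  proof (rule alternating_form_SucI)
    fix v
    have "alternating_form (Suc s) (ext_prod (\<lambda>u us. L u (v # us)))"
      by (intro IH.IH alternating_form_contract IH.prems)
    then have "alternating_form (Suc s) (\<lambda>vs. L v vs + - ext_prod (\<lambda>u us. L u (v # us)) vs)"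
      by (intro alternating_form_add alternating_form_minus IH.prems)
    then show "alternating_form (Suc s) (\<lambda>vs. ext_prod L (v # vs))"
      by (simp add: ext_prod_Cons)
  next
    fix vs
    show "linear (\<lambda>v. ext_prod L (v # vs))"
      unfolding ext_prod_Cons
      by (intro linear_compose_sub IH.prems ext_prod_linear alternating_form_linear_Cons[OF IH.prems(1)])
  next
    fix v vs
    \<comment> \<open>Unfolding twice makes \<open>L v (v # vs)\<close> cancel and leaves this
      product of forms evaluated on a repeated argument.\<close>
    have "ext_prod (\<lambda>u us. L u (v # v # us)) vs = 0"
      using alternating_form_repeat[OF IH.prems(1), of 0 1 "v # v # _"] by simp
    then show "ext_prod L (v # v # vs) = 0" by (simp add: ext_prod_Cons)
  qed simp
next
  case 0
  have L0: "L u (v # us) = 0" for u v us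
    using alternating_form_length[OF 0(1)] by simp
  then have L: "ext_prod L (v # vs) = L v vs" for v vs
    by (simp add: ext_prod_Cons)
  show ?case
    by (rule alternating_form_SucI) (use 0 L L0 in auto)
qed

section \<open>Operators on forms with polynomial coefficients\<close>

text \<open>A class stable under contraction and directional derivatives without tracking of the
  bidegree, which suits inductions on the argument list over arbitrary forms.\<close>

definition poly_coeffs :: "'n::finite form \<Rightarrow> bool"
  where "poly_coeffs \<omega> \<longleftrightarrow> (\<forall>vs. real_polynomial_function (\<lambda>x. \<omega> x vs))"

definition fderiv :: "real^'n \<Rightarrow> 'n::finite form \<Rightarrow> 'n form"
  where "fderiv v \<omega> = (\<lambda>x vs. dird v (\<lambda>y. \<omega> y vs) x)"

definition contract :: "real^'n \<Rightarrow> 'n::finite form \<Rightarrow> 'n form"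
  where "contract v \<omega> = (\<lambda>x vs. \<omega> x (v # vs))"

text \<open>Exterior product with the one-form dual to the field \<open>X\<close>. The identity
  field gives the radial operator \<epsilon>; constant fields appear when \<epsilon> is
  differentiated.\<close>

definition wedge :: "(real^'n \<Rightarrow> real^'n) \<Rightarrow> 'n::finite form \<Rightarrow> 'n form"
  where "wedge X \<omega> = (\<lambda>x. ext_prod (\<lambda>u us. (X x \<bullet> u) * \<omega> x us))"

text \<open>On alternating forms this is insertion of \<open>x\<close> in the first slot; the
  expansion in coordinates lets the product rule act on the factors \<open>x $ j\<close>.\<close>

definition radial_contract :: "'n::finite form \<Rightarrow> 'n form"
  where "radial_contract \<omega> = (\<lambda>x vs. \<Sum>j\<in>UNIV. x $ j * \<omega> x (axis j 1 # vs))"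

lemma dform_eq_ext_prod: "dform \<omega> x = ext_prod (\<lambda>u us. fderiv u \<omega> x us)"
  by (simp add: dform_def ext_prod_def fderiv_def fun_eq_iff)

lemma dform_Nil [simp]: "dform \<omega> x [] = 0"
  by (simp add: dform_eq_ext_prod)

lemma dform_Cons: "dform \<omega> x (v # vs) = fderiv v \<omega> x vs - dform (contract v \<omega>) x vs"
  by (simp add: dform_eq_ext_prod ext_prod_Cons fderiv_def contract_def)

lemma contract_dform: "contract v (dform \<omega>) = fderiv v \<omega> - dform (contract v \<omega>)"
  by (simp add: contract_def[of v "dform \<omega>"] dform_Cons fun_eq_iff)

lemma wedge_Nil [simp]: "wedge X \<omega> x [] = 0"
  by (simp add: wedge_def)

lemma wedge_Cons: "wedge X \<omega> x (v # vs) = (X x \<bullet> v) * \<omega> x vs - wedge X (contract v \<omega>) x vs"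
  by (simp add: wedge_def ext_prod_Cons contract_def)

lemma contract_wedge: "contract v (wedge X \<omega>) x vs = (X x \<bullet> v) * \<omega> x vs - wedge X (contract v \<omega>) x vs"
  by (simp add: contract_def[of v "wedge X \<omega>"] wedge_Cons)

lemma codiff_eq: "codiff \<omega> x vs = - (\<Sum>j\<in>UNIV. fderiv (axis j 1) \<omega> x (axis j 1 # vs))"
  by (simp add: codiff_def fderiv_def)

section \<open>Stability of polynomial coefficients and rules of differentiation\<close>

lemma poly_coeffsD: "poly_coeffs \<omega> \<Longrightarrow> real_polynomial_function (\<lambda>x. \<omega> x vs)"
  by (simp add: poly_coeffs_def)

lemma poly_coeffs_fderiv: "poly_coeffs \<omega> \<Longrightarrow> poly_coeffs (fderiv v \<omega>)"
  by (simp add: poly_coeffs_def fderiv_def real_polynomial_function_dird)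

lemma poly_coeffs_contract: "poly_coeffs \<omega> \<Longrightarrow> poly_coeffs (contract v \<omega>)"
  by (simp add: poly_coeffs_def contract_def)

lemma real_polynomial_function_cmult:
  "real_polynomial_function p \<Longrightarrow> real_polynomial_function (\<lambda>x. c * p x)"
  by (intro real_polynomial_function.intros(2,4))

lemma poly_coeffs_dform: "poly_coeffs \<omega> \<Longrightarrow> poly_coeffs (dform \<omega>)"
  by (simp add: poly_coeffs_def dform_def real_polynomial_function_sum
      real_polynomial_function_cmult real_polynomial_function_dird)

lemma real_polynomial_function_inner: "real_polynomial_function (\<lambda>x. x \<bullet> v)"
  by (intro real_polynomial_function.intros bounded_linear_inner_left)

lemma real_polynomial_function_nth: "real_polynomial_function (\<lambda>x::real^'n::finite. x $ j)"
  by (intro real_polynomial_function.intros bounded_linear_vec_nth)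

lemma dird_inner: "dird v (\<lambda>x. x \<bullet> u) x = v \<bullet> u"
  using dird_bounded_linear[OF bounded_linear_inner_left] by auto

lemma dird_nth: "dird v (\<lambda>x::real^'n::finite. x $ j) x = v $ j"
  using dird_bounded_linear[OF bounded_linear_vec_nth] by auto

lemma poly_coeffs_wedge: "poly_coeffs \<omega> \<Longrightarrow> poly_coeffs (wedge (\<lambda>x. x) \<omega>)"
  unfolding poly_coeffs_def wedge_def ext_prod_def
  by (intro allI real_polynomial_function_sum finite_lessThan real_polynomial_function_cmult
      real_polynomial_function.intros(4) real_polynomial_function_inner) auto

lemma fderiv_diff:
  "poly_coeffs \<omega> \<Longrightarrow> poly_coeffs \<eta> \<Longrightarrow> fderiv v (\<omega> - \<eta>) = fderiv v \<omega> - fderiv v \<eta>"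
  by (simp add: fderiv_def fun_eq_iff dird_diff poly_coeffs_def)

lemma fderiv_commute: "poly_coeffs \<omega> \<Longrightarrow> fderiv v (fderiv w \<omega>) = fderiv w (fderiv v \<omega>)"
  by (simp add: fderiv_def fun_eq_iff dird_commute poly_coeffs_def)

lemma dform_diff:
  "poly_coeffs \<omega> \<Longrightarrow> poly_coeffs \<eta> \<Longrightarrow> dform (\<omega> - \<eta>) = dform \<omega> - dform \<eta>"
  by (simp add: fun_eq_iff dform_eq_ext_prod fderiv_diff ext_prod_diff)

lemma wedge_diff: "wedge X (\<omega> - \<eta>) = wedge X \<omega> - wedge X \<eta>"
  by (simp add: wedge_def fun_eq_iff right_diff_distrib ext_prod_diff)

lemma fderiv_dform:
  assumes "poly_coeffs \<omega>"
  shows "fderiv v (dform \<omega>) = dform (fderiv v \<omega>)"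
proof -
  have "dird v (\<lambda>y. dform \<omega> y vs) x = dform (fderiv v \<omega>) x vs" for x vs
    using assms
    by (simp add: dform_def dird_sum dird_cmult fderiv_def real_polynomial_function_cmult
        real_polynomial_function_dird poly_coeffsD dird_commute[of _ v])
  then show ?thesis by (simp add: fderiv_def[of v "dform \<omega>"])
qed

text \<open>Product rule: the identity field has derivative \<open>v\<close> in direction
  \<open>v\<close>, which produces the wedge with a constant field.\<close>

lemma fderiv_wedge:
  assumes "poly_coeffs \<omega>"
  shows "fderiv v (wedge (\<lambda>x. x) \<omega>) = wedge (\<lambda>x. v) \<omega> + wedge (\<lambda>x. x) (fderiv v \<omega>)"
proof -
  have "dird v (\<lambda>y. wedge (\<lambda>x. x) \<omega> y vs) x
      = wedge (\<lambda>x. v) \<omega> x vs + wedge (\<lambda>x. x) (fderiv v \<omega>) x vs" for x vs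
    using assms
    by (simp add: wedge_def ext_prod_def dird_sum dird_cmult fderiv_def real_polynomial_function_cmult
        real_polynomial_function.intros real_polynomial_function_inner poly_coeffsD dird_mult dird_inner
        flip: sum.distrib) (simp add: algebra_simps)
  then show ?thesis by (simp add: fderiv_def[of v "wedge (\<lambda>x. x) \<omega>"] fun_eq_iff)
qed

text \<open>The identity \<open>\<iota>\<^sub>v d + d \<iota>\<^sub>v = \<partial>\<^sub>v\<close> for constant \<open>v\<close> allows identities between forms to be
  proved by induction on the list of arguments.\<close>

lemma dform_dform:
  assumes "poly_coeffs \<omega>"
  shows "dform (dform \<omega>) = 0"
proof -
  have "dform (dform \<omega>) x vs = 0" for x vs
    using assms
  proof (induction vs arbitrary: \<omega>)
    case (Cons v vs)
    then have "dform (contract v (dform \<omega>))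
        = dform (fderiv v \<omega>) - dform (dform (contract v \<omega>))"
      by (simp add: contract_dform dform_diff poly_coeffs_fderiv poly_coeffs_contract poly_coeffs_dform)
    \<comment> \<open>The two copies of \<open>dform (fderiv v \<omega>)\<close> cancel, and the
      induction hypothesis for the contraction removes the rest.\<close>
    with Cons show ?case by (simp add: dform_Cons fderiv_dform poly_coeffs_contract)
  qed simp
  then show ?thesis by (simp add: fun_eq_iff)
qed

text \<open>The radial one-form is closed, being the differential of half the squared norm, so
  \<open>dform\<close> passes it with only a sign.\<close>

lemma dform_wedge:
  assumes "poly_coeffs \<omega>"
  shows "dform (wedge (\<lambda>x. x) \<omega>) = - wedge (\<lambda>x. x) (dform \<omega>)"
proof -
  let ?e = "wedge (\<lambda>x::real^'a. x)"
  have "dform (?e \<omega>) x vs + ?e (dform \<omega>) x vs = 0" for x vs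
    using assms
  proof (induction vs arbitrary: \<omega>)
    case (Cons v vs)
    note p = Cons.prems poly_coeffs_contract[OF Cons.prems, of v]
    let ?f = "\<lambda>x vs. (x \<bullet> v) * \<omega> x vs"
    have f: "poly_coeffs ?f"
      using p unfolding poly_coeffs_def
      by (auto intro: real_polynomial_function.intros real_polynomial_function_inner)
    have "fderiv u ?f x us = (x \<bullet> v) * fderiv u \<omega> x us + (v \<bullet> u) * \<omega> x us" for u us
      using p by (simp add: fderiv_def dird_mult dird_inner real_polynomial_function_inner
          poly_coeffsD inner_commute)
    \<comment> \<open>The wedge term comes from the coefficient \<open>x \<bullet> v\<close>, whose
      derivative in direction \<open>u\<close> is \<open>v \<bullet> u\<close>.\<close>
    then have df: "dform ?f x vs = (x \<bullet> v) * dform \<omega> x vs + wedge (\<lambda>x. v) \<omega> x vs"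
      by (simp add: dform_eq_ext_prod wedge_def ext_prod_add ext_prod_cmult)
    have "contract v (?e \<omega>) = ?f - ?e (contract v \<omega>)"
      by (simp add: fun_eq_iff contract_wedge)
    then have "dform (contract v (?e \<omega>)) x vs
        = (x \<bullet> v) * dform \<omega> x vs + wedge (\<lambda>x. v) \<omega> x vs - dform (?e (contract v \<omega>)) x vs"
      using f p df by (simp add: dform_diff poly_coeffs_wedge)
    moreover have "?e (contract v (dform \<omega>)) x vs
        = ?e (fderiv v \<omega>) x vs - ?e (dform (contract v \<omega>)) x vs"
      by (simp add: contract_dform wedge_diff)
    \<comment> \<open>The wedges with the constant field, the multiples of
      \<open>dform \<omega>\<close> and the terms in \<open>fderiv v \<omega>\<close> cancel in
      pairs, leaving the induction hypothesis for \<open>contract v \<omega>\<close>.\<close>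
    ultimately show ?case
      using Cons.IH[OF p(2)] p by (simp add: dform_Cons wedge_Cons fderiv_wedge)
  qed simp
  then show ?thesis by (simp add: fun_eq_iff add_eq_0_iff2)
qed

section \<open>Homogeneous polynomial forms\<close>

lemma homogeneous_polynomial_cmult:
  "homogeneous_polynomial k p \<Longrightarrow> homogeneous_polynomial k (\<lambda>x. c * p x)"
  by (auto simp: homogeneous_polynomial_def real_polynomial_function_cmult)

lemma homogeneous_polynomial_minus:
  "homogeneous_polynomial k p \<Longrightarrow> homogeneous_polynomial k (\<lambda>x. - p x)"
  using homogeneous_polynomial_cmult[of k p "-1"] by simp

lemma homogeneous_polynomial_add:
  "homogeneous_polynomial k p \<Longrightarrow> homogeneous_polynomial k q \<Longrightarrow>
    homogeneous_polynomial k (\<lambda>x. p x + q x)"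
  by (auto simp: homogeneous_polynomial_def algebra_simps)

lemma homogeneous_polynomial_zero [simp]: "homogeneous_polynomial k (\<lambda>x. 0)"
  by (simp add: homogeneous_polynomial_def real_polynomial_function.intros)

lemma homogeneous_polynomial_sum:
  "(\<And>i. i \<in> I \<Longrightarrow> homogeneous_polynomial k (p i)) \<Longrightarrow>
    homogeneous_polynomial k (\<lambda>x. \<Sum>i\<in>I. p i x)"
  by (induction I rule: infinite_finite_induct) (auto intro: homogeneous_polynomial_add)

lemma homogeneous_polynomial_linear_mult:
  assumes "bounded_linear f" "homogeneous_polynomial k p"
  shows "homogeneous_polynomial (Suc k) (\<lambda>x. f x * p x)"
  using assms linear_cmul[OF bounded_linear.linear[OF assms(1)]]
  by (simp add: homogeneous_polynomial_def real_polynomial_function.intros(1,4))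

lemma poly_forms_alternating: "\<omega> \<in> poly_forms s k \<Longrightarrow> alternating_form s (\<omega> x)"
  by (simp add: poly_forms_def)

lemma poly_forms_homogeneous: "\<omega> \<in> poly_forms s k \<Longrightarrow> homogeneous_polynomial k (\<lambda>x. \<omega> x vs)"
  by (simp add: poly_forms_def)

lemma poly_forms_poly_coeffs: "\<omega> \<in> poly_forms s k \<Longrightarrow> poly_coeffs \<omega>"
  by (simp add: poly_forms_def poly_coeffs_def homogeneous_polynomial_def)

lemma poly_forms_zero: "0 \<in> poly_forms s k"
  by (simp add: poly_forms_def) (simp add: zero_fun_def)

lemma poly_forms_add:
  "\<omega> \<in> poly_forms s k \<Longrightarrow> \<eta> \<in> poly_forms s k \<Longrightarrow> \<omega> + \<eta> \<in> poly_forms s k"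
  by (simp add: poly_forms_def homogeneous_polynomial_add)
     (simp add: plus_fun_def alternating_form_add)

lemma poly_forms_scaleR: "\<omega> \<in> poly_forms s k \<Longrightarrow> c *\<^sub>R \<omega> \<in> poly_forms s k"
  by (simp add: poly_forms_def homogeneous_polynomial_cmult)
     (simp add: scaleR_fun_def alternating_form_cmult)

lemma alternating_form_fderiv:
  assumes \<omega>: "\<And>x. alternating_form s (\<omega> x)" and p: "poly_coeffs \<omega>"
  shows "alternating_form s (fderiv v \<omega> x)"
  unfolding alternating_form_def
proof (intro conjI allI impI)
  fix vs :: "(real^'a) list" and i assume "length vs = s" "i < s"
  then have l: "linear (\<lambda>u. \<omega> y (vs[i := u]))" for y
    using \<omega> by (simp add: alternating_form_def)
  show "linear (\<lambda>u. fderiv v \<omega> x (vs[i := u]))"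
    by (rule linearI)
       (simp_all add: fderiv_def linear_add[OF l] linear_cmul[OF l] dird_add dird_cmult p poly_coeffsD)
next
  fix vs :: "(real^'a) list" and i j
  assume "length vs = s" "i < j" "j < s" "vs ! i = vs ! j"
  then show "fderiv v \<omega> x vs = 0"
    using alternating_form_repeat[OF \<omega>, of i j vs] by (simp add: fderiv_def)
qed (simp add: fderiv_def alternating_form_length[OF \<omega>])

section \<open>Effect of the operators on the bidegree\<close>

lemma poly_forms_dform:
  assumes "\<omega> \<in> poly_forms s (Suc k)"
  shows "dform \<omega> \<in> poly_forms (Suc s) k"
proof -
  have "alternating_form (Suc s) (dform \<omega> x)" for x
    unfolding dform_eq_ext_prod
  proof (rule alternating_form_ext_prod)
    show "alternating_form s (fderiv v \<omega> x)" for v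
      by (rule alternating_form_fderiv)
         (use assms poly_forms_alternating poly_forms_poly_coeffs in blast)+
    show "linear (\<lambda>v. fderiv v \<omega> x vs)" for vs
      using poly_forms_poly_coeffs[OF assms] by (simp add: fderiv_def linear_dird poly_coeffsD)
  qed
  moreover have "homogeneous_polynomial k (\<lambda>x. dform \<omega> x vs)" for vs
    unfolding dform_def using poly_forms_homogeneous[OF assms]
    by (intro homogeneous_polynomial_sum homogeneous_polynomial_cmult homogeneous_polynomial_dird)
  ultimately show ?thesis by (simp add: poly_forms_def)
qed

lemma poly_forms_codiff:
  assumes "\<omega> \<in> poly_forms (Suc s) (Suc k)"
  shows "codiff \<omega> \<in> poly_forms s k"
proof -
  have "alternating_form s (codiff \<omega> x)" for x
    unfolding codiff_eq[abs_def]
    by (intro alternating_form_minus alternating_form_sum alternating_form_contract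
        alternating_form_fderiv poly_forms_alternating[OF assms] poly_forms_poly_coeffs[OF assms])
  moreover have "homogeneous_polynomial k (\<lambda>x. codiff \<omega> x vs)" for vs
    unfolding codiff_def using poly_forms_homogeneous[OF assms]
    by (intro homogeneous_polynomial_minus homogeneous_polynomial_sum homogeneous_polynomial_dird)
  ultimately show ?thesis by (simp add: poly_forms_def)
qed

lemma poly_forms_wedge:
  assumes "\<omega> \<in> poly_forms s k"
  shows "wedge (\<lambda>x. x) \<omega> \<in> poly_forms (Suc s) (Suc k)"
proof -
  have "alternating_form (Suc s) (wedge (\<lambda>x. x) \<omega> x)" for x
    unfolding wedge_def
  proof (rule alternating_form_ext_prod)
    show "linear (\<lambda>v. (x \<bullet> v) * \<omega> x vs)" for vs
      by (simp add: linear_iff algebra_simps inner_add_right)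
  qed (use assms poly_forms_alternating alternating_form_cmult in blast)
  moreover have "homogeneous_polynomial (Suc k) (\<lambda>x. wedge (\<lambda>x. x) \<omega> x vs)" for vs
    unfolding wedge_def ext_prod_def using poly_forms_homogeneous[OF assms]
    by (intro homogeneous_polynomial_sum homogeneous_polynomial_cmult
        homogeneous_polynomial_linear_mult bounded_linear_inner_left)
  ultimately show ?thesis by (simp add: poly_forms_def)
qed

lemma poly_forms_radial_contract:
  assumes "\<omega> \<in> poly_forms (Suc s) k"
  shows "radial_contract \<omega> \<in> poly_forms s (Suc k)"
proof -
  have "alternating_form s (radial_contract \<omega> x)" for x
    unfolding radial_contract_def
    by (intro alternating_form_sum alternating_form_cmult alternating_form_contract
        poly_forms_alternating[OF assms])
  moreover have "homogeneous_polynomial (Suc k) (\<lambda>x. radial_contract \<omega> x vs)" for vs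
    unfolding radial_contract_def using poly_forms_homogeneous[OF assms]
    by (intro homogeneous_polynomial_sum homogeneous_polynomial_linear_mult bounded_linear_vec_nth)
  ultimately show ?thesis by (simp add: poly_forms_def)
qed

section \<open>Extreme degrees, where the differential or the codifferential vanishes\<close>

lemma fderiv_degree_0: "\<omega> \<in> poly_forms s 0 \<Longrightarrow> fderiv v \<omega> = 0"
  by (simp add: fderiv_def fun_eq_iff homogeneous_polynomial_0_dird poly_forms_homogeneous)

lemma dform_degree_0: "\<omega> \<in> poly_forms s 0 \<Longrightarrow> dform \<omega> = 0"
  by (simp add: fun_eq_iff dform_eq_ext_prod fderiv_degree_0)

lemma codiff_degree_0: "\<omega> \<in> poly_forms s 0 \<Longrightarrow> codiff \<omega> = 0"
  by (simp add: fun_eq_iff codiff_eq fderiv_degree_0)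

lemma codiff_function: "\<omega> \<in> poly_forms 0 k \<Longrightarrow> codiff \<omega> = 0"
  by (simp add: fun_eq_iff codiff_def alternating_form_length[OF poly_forms_alternating])

text \<open>The differential would have form degree above \<open>CARD('n)\<close>, where alternating
  forms vanish. Polynomial degree 0 is separate because \<open>poly_forms_dform\<close> starts from
  \<open>Suc k\<close>.\<close>

lemma dform_top:
  fixes \<omega> :: "'n::finite form"
  assumes "\<omega> \<in> poly_forms s k" "CARD('n) \<le> s"
  shows "dform \<omega> = 0"
proof (cases k)
  case 0
  with assms show ?thesis by (simp add: dform_degree_0)
next
  case (Suc l)
  with assms have "dform \<omega> x vs = 0" for x vs
    by (intro alternating_form_eq_0_of_card_less[OF poly_forms_alternating[OF poly_forms_dform]]) auto
  then show ?thesis by (simp add: fun_eq_iff)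
qed

section \<open>Linearity of the operators\<close>

lemma dform_add:
  "poly_coeffs \<omega> \<Longrightarrow> poly_coeffs \<eta> \<Longrightarrow> dform (\<omega> + \<eta>) = dform \<omega> + dform \<eta>"
  by (simp add: fun_eq_iff dform_def dird_add poly_coeffs_def sum.distrib algebra_simps)

lemma dform_scaleR: "poly_coeffs \<omega> \<Longrightarrow> dform (c *\<^sub>R \<omega>) = c *\<^sub>R dform \<omega>"
  by (simp add: fun_eq_iff dform_def dird_cmult poly_coeffs_def sum_distrib_left algebra_simps)

lemma codiff_add:
  "poly_coeffs \<omega> \<Longrightarrow> poly_coeffs \<eta> \<Longrightarrow> codiff (\<omega> + \<eta>) = codiff \<omega> + codiff \<eta>"
  by (simp add: fun_eq_iff codiff_def dird_add poly_coeffs_def sum.distrib)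

lemma codiff_scaleR: "poly_coeffs \<omega> \<Longrightarrow> codiff (c *\<^sub>R \<omega>) = c *\<^sub>R codiff \<omega>"
  by (simp add: fun_eq_iff codiff_def dird_cmult poly_coeffs_def sum_distrib_left)

lemma poly_coeffs_scaleR: "poly_coeffs \<omega> \<Longrightarrow> poly_coeffs (c *\<^sub>R \<omega>)"
  by (simp add: poly_coeffs_def real_polynomial_function_cmult)

lemma poly_coeffs_codiff: "poly_coeffs \<omega> \<Longrightarrow> poly_coeffs (codiff \<omega>)"
  by (simp add: poly_coeffs_def codiff_def real_polynomial_function_sum
      real_polynomial_function_minus real_polynomial_function_dird)

lemma dform_zero [simp]: "dform 0 = 0"
  using dform_degree_0[OF poly_forms_zero] .

lemma codiff_zero [simp]: "codiff 0 = 0"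
  using codiff_degree_0[OF poly_forms_zero] .

lemma wedge_scaleR: "wedge X (c *\<^sub>R \<omega>) = c *\<^sub>R wedge X \<omega>"
  by (simp add: wedge_def fun_eq_iff mult.left_commute[of _ c] ext_prod_cmult)

lemma radial_contract_scaleR: "radial_contract (c *\<^sub>R \<omega>) = c *\<^sub>R radial_contract \<omega>"
  by (simp add: radial_contract_def fun_eq_iff sum_distrib_left mult.left_commute[of _ c])

lemma radial_contract_zero [simp]: "radial_contract 0 = 0"
  by (simp add: radial_contract_def fun_eq_iff)

lemma wedge_zero [simp]: "wedge X 0 = 0"
  by (simp add: wedge_def fun_eq_iff)

text \<open>Second derivatives are symmetric in the two basis directions while the form is
  antisymmetric in the two contracted slots, so the double sum equals its own negative.\<close>

lemma codiff_codiff: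
  assumes "\<omega> \<in> poly_forms s k"
  shows "codiff (codiff \<omega>) = 0"
proof -
  note p = poly_forms_poly_coeffs[OF assms]
  let ?e = "\<lambda>j::'a. axis j (1::real)"
  have alt: "alternating_form s (fderiv u (fderiv v \<omega>) x)" for u v x
    by (intro alternating_form_fderiv poly_forms_alternating[OF assms] p poly_coeffs_fderiv)
  have "codiff (codiff \<omega>) x vs = 0" for x vs
  proof -
    define S where "S = (\<Sum>i\<in>UNIV. \<Sum>j\<in>UNIV. fderiv (?e i) (fderiv (?e j) \<omega>) x (?e j # ?e i # vs))"
    have "fderiv (?e i) (codiff \<omega>) x us = - (\<Sum>j\<in>UNIV. fderiv (?e i) (fderiv (?e j) \<omega>) x (?e j # us))"
      for i us
      using p by (simp add: fderiv_def codiff_def dird_minus dird_sum real_polynomial_function_sum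
          real_polynomial_function_dird poly_coeffsD)
    then have "codiff (codiff \<omega>) x vs = S"
      by (simp add: codiff_eq sum_negf S_def)
    moreover have "S = - S"
    proof -
      have "S = (\<Sum>j\<in>UNIV. \<Sum>i\<in>UNIV. fderiv (?e i) (fderiv (?e j) \<omega>) x (?e j # ?e i # vs))"
        unfolding S_def by (rule sum.swap)
      also have "\<dots> = (\<Sum>j\<in>UNIV. \<Sum>i\<in>UNIV. - fderiv (?e j) (fderiv (?e i) \<omega>) x (?e i # ?e j # vs))"
        by (subst fderiv_commute[OF p], subst alternating_form_Cons_swap[OF alt], rule refl)
      finally show ?thesis by (simp add: sum_negf S_def)
    qed
    ultimately show ?thesis by simp
  qed
  then show ?thesis by (simp add: fun_eq_iff)
qed

section \<open>Anticommutation relations\<close>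

text \<open>The number operator: summing over the basis puts the argument \<open>vs ! i\<close> in
  front, and moving it back to its place cancels the sign \<open>(-1) ^ i\<close>, so each of the
  \<open>s\<close> positions contributes one copy.\<close>

lemma sum_wedge_contract:
  fixes \<omega> :: "'n::finite form"
  assumes "alternating_form s (\<omega> x)"
  shows "(\<Sum>j\<in>UNIV. wedge (\<lambda>x. axis j 1) (contract (axis j 1) \<omega>) x vs) = real s * \<omega> x vs"
proof -
  have "(\<Sum>j\<in>UNIV. wedge (\<lambda>x. axis j 1) (contract (axis j 1) \<omega>) x vs)
      = ext_prod (\<lambda>u us. \<Sum>j\<in>UNIV. u $ j * \<omega> x (axis j 1 # us)) vs"
    by (simp add: wedge_def contract_def ext_prod_sum inner_axis')
  also have "\<dots> = (\<Sum>i<length vs. (-1) ^ i * \<omega> x (vs ! i # take i vs @ drop (Suc i) vs))"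
    by (simp add: linear_axis_expansion[OF alternating_form_linear_Cons[OF assms]] ext_prod_def)
  also have "\<dots> = (\<Sum>i<length vs. \<omega> x vs)"
  proof (rule sum.cong)
    fix i assume "i \<in> {..<length vs}"
    then have i: "i < length vs" by simp
    show "(-1) ^ i * \<omega> x (vs ! i # take i vs @ drop (Suc i) vs) = \<omega> x vs"
    proof (cases "length vs = s")
      case True
      then have "\<omega> x vs = (-1) ^ i * \<omega> x (vs ! i # take i vs @ drop (Suc i) vs)"
        using alternating_move[OF assms, of "take i vs" "vs ! i" "drop (Suc i) vs"] i
        by (simp add: id_take_nth_drop[symmetric])
      then show ?thesis by simp
    qed (use i in \<open>simp add: alternating_form_length[OF assms]\<close>)
  qed simp
  also have "\<dots> = real s * \<omega> x vs"
    using alternating_form_length[OF assms, of vs] by (cases "length vs = s") auto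
  finally show ?thesis .
qed

text \<open>The sum is the derivative in direction \<open>x\<close>, to which Euler's identity
  applies.\<close>

lemma sum_nth_fderiv:
  assumes "\<omega> \<in> poly_forms s k"
  shows "(\<Sum>j\<in>UNIV. x $ j * fderiv (axis j 1) \<omega> x vs) = real k * \<omega> x vs"
  unfolding fderiv_def
  using linear_axis_expansion[OF linear_dird[OF poly_coeffsD[OF poly_forms_poly_coeffs[OF assms]]]]
    homogeneous_polynomial_euler[OF poly_forms_homogeneous[OF assms]] by simp

text \<open>Cartan's formula for the radial field: its Lie derivative multiplies by \<open>k\<close>
  through the coefficients and by \<open>s\<close> through the differentials of the
  coordinates.\<close>

lemma dform_radial_contract:
  assumes "\<omega> \<in> poly_forms s k"
  shows "dform (radial_contract \<omega>) = real (k + s) *\<^sub>R \<omega> - radial_contract (dform \<omega>)"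
proof -
  note p = poly_forms_poly_coeffs[OF assms]
  let ?e = "\<lambda>j::'a. axis j (1::real)"
  have "dform (radial_contract \<omega>) x vs = real (k + s) * \<omega> x vs - radial_contract (dform \<omega>) x vs" for x vs
  proof -
    \<comment> \<open>Differentiating \<open>x $ j\<close> gives the first term, which becomes the
      number operator; the second cancels against part of
      \<open>radial_contract (dform \<omega>)\<close>.\<close>
    have "fderiv u (radial_contract \<omega>) x us = (\<Sum>j\<in>UNIV. (?e j \<bullet> u) * contract (?e j) \<omega> x us
        + x $ j * fderiv u (contract (?e j) \<omega>) x us)" for u us
      using p by (simp add: fderiv_def radial_contract_def contract_def dird_sum dird_mult dird_nth
          real_polynomial_function.intros(4) real_polynomial_function_nth poly_coeffsD inner_axis' add.commute)
    then have "dform (radial_contract \<omega>) x vs = (\<Sum>j\<in>UNIV. wedge (\<lambda>x. ?e j) (contract (?e j) \<omega>) x vs)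
        + (\<Sum>j\<in>UNIV. x $ j * dform (contract (?e j) \<omega>) x vs)"
      by (simp add: dform_eq_ext_prod wedge_def ext_prod_sum ext_prod_add ext_prod_cmult sum.distrib)
    moreover have "radial_contract (dform \<omega>) x vs
        = (\<Sum>j\<in>UNIV. x $ j * fderiv (?e j) \<omega> x vs) - (\<Sum>j\<in>UNIV. x $ j * dform (contract (?e j) \<omega>) x vs)"
      by (simp add: radial_contract_def dform_Cons algebra_simps sum_subtractf)
    ultimately show ?thesis
      using sum_wedge_contract[OF poly_forms_alternating[OF assms]] sum_nth_fderiv[OF assms]
      by (simp add: algebra_simps)
  qed
  then show ?thesis by (simp add: fun_eq_iff)
qed

text \<open>Insertions of \<open>x\<close> and of a basis vector anticommute; the term from
  differentiating \<open>x $ j\<close> has the same basis vector inserted twice and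
  vanishes.\<close>

lemma codiff_radial_contract:
  assumes "\<omega> \<in> poly_forms s k"
  shows "codiff (radial_contract \<omega>) = - radial_contract (codiff \<omega>)"
proof -
  note p = poly_forms_poly_coeffs[OF assms]
  let ?e = "\<lambda>j::'a. axis j (1::real)"
  have alt: "alternating_form s (fderiv u \<omega> x)" for u x
    by (intro alternating_form_fderiv poly_forms_alternating[OF assms] p)
  have "codiff (radial_contract \<omega>) x vs = - radial_contract (codiff \<omega>) x vs" for x vs
  proof -
    have "\<omega> x (?e j # ?e j # vs) = 0" for j
      using alternating_form_Cons_swap[OF poly_forms_alternating[OF assms], of x "?e j" "?e j" vs] by simp
    then have "fderiv (?e j) (radial_contract \<omega>) x (?e j # vs)
        = (\<Sum>i\<in>UNIV. x $ i * fderiv (?e j) \<omega> x (?e i # ?e j # vs))" for j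
      using p by (simp add: fderiv_def radial_contract_def dird_sum dird_mult dird_nth
          real_polynomial_function.intros(4) real_polynomial_function_nth poly_coeffsD sum.distrib
          axis_def[of _ "1::real"] if_distrib[of "\<lambda>t. t * _"] cong: if_cong)
    also have "\<dots> j = - (\<Sum>i\<in>UNIV. x $ i * fderiv (?e j) \<omega> x (?e j # ?e i # vs))" for j
      by (subst alternating_form_Cons_swap[OF alt]) (simp add: sum_negf)
    finally have "codiff (radial_contract \<omega>) x vs
        = (\<Sum>j\<in>UNIV. \<Sum>i\<in>UNIV. x $ i * fderiv (?e j) \<omega> x (?e j # ?e i # vs))"
      by (simp add: codiff_eq sum_negf)
    also have "\<dots> = - radial_contract (codiff \<omega>) x vs"
      unfolding radial_contract_def codiff_eq
      by (subst sum.swap) (simp add: sum_distrib_left sum_negf)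
    finally show ?thesis .
  qed
  then show ?thesis by (simp add: fun_eq_iff)
qed

text \<open>Counterpart of \<open>dform_radial_contract\<close>: the constant combines Euler's
  identity, the trace of the inner product, and the number operator with a minus sign.\<close>

lemma codiff_wedge:
  fixes \<omega> :: "'n::finite form"
  assumes "\<omega> \<in> poly_forms s k"
  shows "codiff (wedge (\<lambda>x. x) \<omega>)
    = - (real k + real CARD('n) - real s) *\<^sub>R \<omega> - wedge (\<lambda>x. x) (codiff \<omega>)"
proof -
  note p = poly_forms_poly_coeffs[OF assms]
  let ?e = "\<lambda>j::'n. axis j (1::real)"
  have "codiff (wedge (\<lambda>x. x) \<omega>) x vs
    = - (real k + real CARD('n) - real s) * \<omega> x vs - wedge (\<lambda>x. x) (codiff \<omega>) x vs" for x vs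
  proof -
    have "fderiv (?e j) (wedge (\<lambda>x. x) \<omega>) x (?e j # vs)
      = \<omega> x vs - wedge (\<lambda>x. ?e j) (contract (?e j) \<omega>) x vs + x $ j * fderiv (?e j) \<omega> x vs
        - wedge (\<lambda>x. x) (contract (?e j) (fderiv (?e j) \<omega>)) x vs" for j
      by (simp add: fderiv_wedge[OF p] wedge_Cons inner_axis)
    then have "codiff (wedge (\<lambda>x. x) \<omega>) x vs
      = - (real CARD('n) * \<omega> x vs - real s * \<omega> x vs + real k * \<omega> x vs
        - (\<Sum>j\<in>UNIV. wedge (\<lambda>x. x) (contract (?e j) (fderiv (?e j) \<omega>)) x vs))"
      using sum_wedge_contract[OF poly_forms_alternating[OF assms]] sum_nth_fderiv[OF assms]
      by (simp add: codiff_eq sum_subtractf sum.distrib)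
    moreover have "wedge (\<lambda>x. x) (codiff \<omega>) x vs
        = - (\<Sum>j\<in>UNIV. wedge (\<lambda>x. x) (contract (?e j) (fderiv (?e j) \<omega>)) x vs)"
      by (simp add: wedge_def codiff_eq contract_def ext_prod_minus sum_distrib_left flip: ext_prod_sum)
    ultimately show ?thesis by (simp add: algebra_simps)
  qed
  then show ?thesis by (simp add: fun_eq_iff)
qed

section \<open>Equivariance\<close>

lemma orthogonal_transformation_inv_inner:
  fixes g :: "real^'n::finite \<Rightarrow> real^'n"
  assumes "orthogonal_transformation g"
  shows "inv g u \<bullet> v = u \<bullet> g v"
  using assms orthogonal_transformation_surj[OF assms]
  by (metis orthogonal_transformation_def surj_f_inv_f)

lemma bounded_linear_orthogonal_inv:
  fixes g :: "real^'n::finite \<Rightarrow> real^'n"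
  shows "orthogonal_transformation g \<Longrightarrow> bounded_linear (inv g)"
  using orthogonal_transformation_inv orthogonal_transformation_linear linear_conv_bounded_linear
  by blast

text \<open>The trace of a bilinear form is the same in every orthonormal basis. This is why
  \<open>codiff\<close>, defined by the standard basis, commutes with the action.\<close>

lemma sum_bilinear_orthogonal:
  fixes g :: "real^'n::finite \<Rightarrow> real^'n" and B :: "real^'n \<Rightarrow> real^'n \<Rightarrow> real"
  assumes g: "orthogonal_transformation g"
    and B: "\<And>v. linear (\<lambda>u. B u v)" "\<And>u. linear (\<lambda>v. B u v)"
  shows "(\<Sum>j\<in>UNIV. B (inv g (axis j 1)) (inv g (axis j 1))) = (\<Sum>j\<in>UNIV. B (axis j 1) (axis j 1))"
proof -
  let ?e = "\<lambda>j::'n. axis j (1::real)"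
  \<comment> \<open>The inverse of an orthogonal map is its transpose.\<close>
  have nth: "inv g (?e j) $ i = g (?e i) $ j" for i j
    using orthogonal_transformation_inv_inner[OF g, of "?e j" "?e i"] by (simp add: inner_axis inner_axis')
  have orth: "(\<Sum>j\<in>UNIV. g (?e i) $ j * g (?e l) $ j) = (if i = l then 1 else 0)" for i l
  proof -
    have "g (?e i) \<bullet> g (?e l) = ?e i \<bullet> ?e l"
      using g by (simp add: orthogonal_transformation_def)
    then show ?thesis by (simp add: inner_axis_axis inner_vec_def[of "g _"])
  qed
  have "(\<Sum>j\<in>UNIV. B (inv g (?e j)) (inv g (?e j)))
      = (\<Sum>j\<in>UNIV. \<Sum>i\<in>UNIV. \<Sum>l\<in>UNIV. g (?e i) $ j * (g (?e l) $ j * B (?e i) (?e l)))"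
    by (subst linear_axis_expansion[OF B(1), symmetric], subst linear_axis_expansion[OF B(2), symmetric])
       (simp add: nth sum_distrib_left)
  also have "\<dots> = (\<Sum>i\<in>UNIV. \<Sum>j\<in>UNIV. \<Sum>l\<in>UNIV. g (?e i) $ j * (g (?e l) $ j * B (?e i) (?e l)))"
    by (rule sum.swap)
  also have "\<dots> = (\<Sum>i\<in>UNIV. \<Sum>l\<in>UNIV. \<Sum>j\<in>UNIV. g (?e i) $ j * (g (?e l) $ j * B (?e i) (?e l)))"
    by (rule sum.cong[OF refl], rule sum.swap)
  also have "\<dots> = (\<Sum>i\<in>UNIV. \<Sum>l\<in>UNIV. (if i = l then 1 else 0) * B (?e i) (?e l))"
    by (simp add: sum_distrib_right mult.assoc flip: orth)
  also have "\<dots> = (\<Sum>j\<in>UNIV. B (?e j) (?e j))"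
    by (simp add: if_distrib[of "\<lambda>t. t * _"] cong: if_cong)
  finally show ?thesis .
qed

lemma poly_forms_form_act:
  assumes g: "orthogonal_transformation g" and \<omega>: "\<omega> \<in> poly_forms s k"
  shows "form_act g \<omega> \<in> poly_forms s k"
proof -
  note bl = bounded_linear_orthogonal_inv[OF g]
  note lin = bounded_linear.linear[OF bl]
  have "alternating_form s (form_act g \<omega> x)" for x
    unfolding alternating_form_def
  proof (intro conjI allI impI)
    fix vs :: "(real^'a) list" and i assume *: "length vs = s" "i < s"
    have "linear (\<lambda>v. \<omega> (inv g x) ((map (inv g) vs)[i := v]))"
      using poly_forms_alternating[OF \<omega>, unfolded alternating_form_def] * by simp
    from linear_compose[OF lin this] show "linear (\<lambda>v. form_act g \<omega> x (vs[i := v]))"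
      by (simp add: form_act_def map_update o_def)
  next
    fix vs :: "(real^'a) list" and i j
    assume "length vs = s" "i < j" "j < s" "vs ! i = vs ! j"
    then show "form_act g \<omega> x vs = 0"
      unfolding form_act_def
      by (intro alternating_form_repeat[OF poly_forms_alternating[OF \<omega>], of i j]) simp_all
  qed (simp add: form_act_def alternating_form_length[OF poly_forms_alternating[OF \<omega>]])
  moreover have "homogeneous_polynomial k (\<lambda>x. form_act g \<omega> x vs)" for vs
    using poly_forms_homogeneous[OF \<omega>, of "map (inv g) vs"] linear_cmul[OF lin]
      real_polynomial_function_compose[OF polynomial_function_bounded_linear[OF bl],
        of "\<lambda>x. \<omega> x (map (inv g) vs)"]
    by (simp add: homogeneous_polynomial_def form_act_def o_def)
  ultimately show ?thesis by (simp add: poly_forms_def)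
qed

lemma fderiv_form_act:
  assumes g: "orthogonal_transformation g" and p: "poly_coeffs \<omega>"
  shows "fderiv v (form_act g \<omega>) x vs = fderiv (inv g v) \<omega> (inv g x) (map (inv g) vs)"
  by (simp add: fderiv_def form_act_def
      dird_comp_linear[OF poly_coeffsD[OF p] bounded_linear_orthogonal_inv[OF g]])

lemma dform_form_act:
  assumes g: "orthogonal_transformation g" and p: "poly_coeffs \<omega>"
  shows "dform (form_act g \<omega>) = form_act g (dform \<omega>)"
proof -
  have "dform (form_act g \<omega>) x vs = dform \<omega> (inv g x) (map (inv g) vs)" for x vs
    by (simp add: dform_eq_ext_prod ext_prod_def fderiv_form_act[OF assms] take_map drop_map)
  then show ?thesis by (simp add: fun_eq_iff form_act_def[of g "dform \<omega>"])
qed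

lemma codiff_form_act:
  assumes g: "orthogonal_transformation g" and \<omega>: "\<omega> \<in> poly_forms s k"
  shows "codiff (form_act g \<omega>) = form_act g (codiff \<omega>)"
proof -
  note p = poly_forms_poly_coeffs[OF \<omega>]
  have "codiff (form_act g \<omega>) x vs = codiff \<omega> (inv g x) (map (inv g) vs)" for x vs
  proof -
    have "linear (\<lambda>u. fderiv u \<omega> (inv g x) (v # map (inv g) vs))" for v
      using p by (simp add: fderiv_def linear_dird poly_coeffsD)
    moreover have "linear (\<lambda>v. fderiv u \<omega> (inv g x) (v # map (inv g) vs))" for u
      by (rule alternating_form_linear_Cons alternating_form_fderiv p poly_forms_alternating[OF \<omega>])+
    ultimately show ?thesis
      using sum_bilinear_orthogonal[OF g, of "\<lambda>u v. fderiv u \<omega> (inv g x) (v # map (inv g) vs)"]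
      by (simp add: codiff_eq fderiv_form_act[OF g p])
  qed
  then show ?thesis by (simp add: fun_eq_iff form_act_def[of g "codiff \<omega>"])
qed

section \<open>Equivariant maps\<close>

text \<open>Linearity is demanded on \<open>S\<close> only, because
  \<open>frechet_derivative\<close> is guaranteed to be linear only in differentiable
  coefficients.\<close>

definition equivariant_on :: "'n::finite form set \<Rightarrow> ('n form \<Rightarrow> 'n form) \<Rightarrow> bool"
  where "equivariant_on S f \<longleftrightarrow>
    (\<forall>x\<in>S. \<forall>y\<in>S. f (x + y) = f x + f y) \<and>
    (\<forall>c. \<forall>x\<in>S. f (c *\<^sub>R x) = c *\<^sub>R f x) \<and>
    (\<forall>g. orthogonal_transformation g \<longrightarrow> (\<forall>x\<in>S. f (form_act g x) = form_act g (f x)))"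

lemma equivariant_onD:
  assumes "equivariant_on S f"
  shows "x \<in> S \<Longrightarrow> y \<in> S \<Longrightarrow> f (x + y) = f x + f y"
    and "x \<in> S \<Longrightarrow> f (c *\<^sub>R x) = c *\<^sub>R f x"
    and "orthogonal_transformation g \<Longrightarrow> x \<in> S \<Longrightarrow> f (form_act g x) = form_act g (f x)"
  using assms by (auto simp: equivariant_on_def)

lemma submoduleD:
  assumes "submodule S"
  shows "0 \<in> S" and "x \<in> S \<Longrightarrow> y \<in> S \<Longrightarrow> x + y \<in> S"
    and "x \<in> S \<Longrightarrow> y \<in> S \<Longrightarrow> x - y \<in> S" and "x \<in> S \<Longrightarrow> c *\<^sub>R x \<in> S"
    and "orthogonal_transformation g \<Longrightarrow> x \<in> S \<Longrightarrow> form_act g x \<in> S"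
  using assms by (auto simp: submodule_def subspace_0 subspace_add subspace_diff subspace_scale)

lemma submoduleI:
  assumes "0 \<in> S" and "\<And>x y. x \<in> S \<Longrightarrow> y \<in> S \<Longrightarrow> x + y \<in> S"
    and "\<And>c x. x \<in> S \<Longrightarrow> c *\<^sub>R x \<in> S"
    and "\<And>g x. orthogonal_transformation g \<Longrightarrow> x \<in> S \<Longrightarrow> form_act g x \<in> S"
  shows "submodule S"
  using assms by (auto simp: submodule_def subspace_def)

lemma form_act_add: "form_act g (\<omega> + \<eta>) = form_act g \<omega> + form_act g \<eta>"
  by (simp add: form_act_def fun_eq_iff)

lemma form_act_zero [simp]: "form_act g 0 = 0"
  by (simp add: form_act_def fun_eq_iff)

lemma form_act_inv:
  assumes "orthogonal_transformation g"
  shows "form_act g (form_act (inv g) \<omega>) = \<omega>"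
  using orthogonal_transformation_bij[OF assms]
  by (simp add: form_act_def inv_inv_eq o_def bij_is_surj surj_f_inv_f)

lemma equivariant_on_zero: "equivariant_on S f \<Longrightarrow> x \<in> S \<Longrightarrow> f 0 = 0"
  using equivariant_onD(2)[of S f x 0] by simp

lemma equivariant_on_diff:
  assumes "equivariant_on S f" "submodule S" "x \<in> S" "y \<in> S"
  shows "f (x - y) = f x - f y"
  using equivariant_onD(1)[OF assms(1), of "x - y" y] submoduleD(3)[OF assms(2-4)] assms(4) by simp

lemma equivariant_on_subset: "equivariant_on S f \<Longrightarrow> T \<subseteq> S \<Longrightarrow> equivariant_on T f"
  unfolding equivariant_on_def by (meson subsetD)

lemma equivariant_on_comp:
  assumes "equivariant_on S f" "f ` S \<subseteq> T" "equivariant_on T h"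
  shows "equivariant_on S (h \<circ> f)"
proof -
  have "f x \<in> T" if "x \<in> S" for x using assms(2) that by auto
  with assms(1,3) show ?thesis by (simp add: equivariant_on_def)
qed

lemma equivariant_on_sum:
  assumes "equivariant_on S f" "equivariant_on S h"
  shows "equivariant_on S (\<lambda>x. f x + h x)"
  using assms by (simp add: equivariant_on_def form_act_add scaleR_add_right algebra_simps)

lemma submodule_kernel:
  assumes "submodule S" "equivariant_on S f"
  shows "submodule {x \<in> S. f x = 0}"
  using submoduleD[OF assms(1)] equivariant_onD[OF assms(2)] equivariant_on_zero[OF assms(2)]
  by (intro submoduleI) auto

lemma submodule_image:
  assumes "submodule S" "equivariant_on S f"
  shows "submodule (f ` S)"
proof (rule submoduleI)
  show "0 \<in> f ` S"
    using submoduleD(1)[OF assms(1)] equivariant_on_zero[OF assms(2)] by (metis image_eqI)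
qed (use submoduleD[OF assms(1)] in \<open>auto simp flip: equivariant_onD[OF assms(2)]\<close>)

lemma submodule_Int: "submodule S \<Longrightarrow> submodule T \<Longrightarrow> submodule (S \<inter> T)"
  by (rule submoduleI) (auto simp: submoduleD)

section \<open>Isomorphisms of modules and quotients\<close>

lemma form_module_iso_iff:
  "form_module S \<simeq>\<^sub>O form_module T \<longleftrightarrow> (\<exists>f. bij_betw f S T \<and> equivariant_on S f)"
  by (simp add: omodule_iso_def form_module_def equivariant_on_def)

lemma omodule_iso_refl: "M \<simeq>\<^sub>O M"
  unfolding omodule_iso_def by (rule exI[of _ id]) auto

lemma omodule_iso_trans:
  assumes "M \<simeq>\<^sub>O N" "N \<simeq>\<^sub>O P"
  shows "M \<simeq>\<^sub>O P"
proof -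
  from assms(1) obtain f where f: "bij_betw f (mcarrier M) (mcarrier N)"
    "\<forall>x\<in>mcarrier M. \<forall>y\<in>mcarrier M. f (madd M x y) = madd N (f x) (f y)"
    "\<forall>c. \<forall>x\<in>mcarrier M. f (mscale M c x) = mscale N c (f x)"
    "\<forall>g. orthogonal_transformation g \<longrightarrow> (\<forall>x\<in>mcarrier M. f (mact M g x) = mact N g (f x))"
    unfolding omodule_iso_def by blast
  from assms(2) obtain h where h: "bij_betw h (mcarrier N) (mcarrier P)"
    "\<forall>x\<in>mcarrier N. \<forall>y\<in>mcarrier N. h (madd N x y) = madd P (h x) (h y)"
    "\<forall>c. \<forall>x\<in>mcarrier N. h (mscale N c x) = mscale P c (h x)"
    "\<forall>g. orthogonal_transformation g \<longrightarrow> (\<forall>x\<in>mcarrier N. h (mact N g x) = mact P g (h x))"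
    unfolding omodule_iso_def by blast
  have "f x \<in> mcarrier N" if "x \<in> mcarrier M" for x
    using bij_betwE[OF f(1)] that by blast
  with f h show ?thesis
    unfolding omodule_iso_def by (intro exI[of _ "h \<circ> f"]) (simp add: bij_betw_trans)
qed

lemma form_module_iso_sym:
  assumes "submodule S" "form_module S \<simeq>\<^sub>O form_module T"
  shows "form_module T \<simeq>\<^sub>O form_module S"
proof -
  obtain f where f: "bij_betw f S T" "equivariant_on S f"
    using assms(2) by (auto simp: form_module_iso_iff)
  have eq: "the_inv_into S f (f x) = x" if "x \<in> S" for x
    using that f(1) by (simp add: bij_betw_def the_inv_into_f_f)
  have T: "T = f ` S" using f(1) by (simp add: bij_betw_def)
  have "equivariant_on T (the_inv_into S f)"
    unfolding equivariant_on_def T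
    using submoduleD[OF assms(1)] by (auto simp: eq simp flip: equivariant_onD[OF f(2)])
  with bij_betw_the_inv_into[OF f(1)] show ?thesis by (auto simp: form_module_iso_iff)
qed

text \<open>First isomorphism theorem. The map sends a value to its fibre, which is a coset of the
  kernel, so that no representatives have to be chosen.\<close>

lemma image_iso_quotient:
  assumes S: "submodule S" and f: "equivariant_on S f"
  shows "form_module (f ` S) \<simeq>\<^sub>O S /\<^sub>O {x \<in> S. f x = 0}"
proof -
  define F where "F t = {x \<in> S. f x = t}" for t
  define R where "R = {(\<omega>, \<eta>). \<omega> \<in> S \<and> \<eta> \<in> S \<and> \<omega> - \<eta> \<in> {x \<in> S. f x = 0}}"
  note Sc = submoduleD[OF S] and fe = equivariant_onD[OF f]
  have RF: "R `` {x} = F (f x)" if "x \<in> S" for x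
    using that Sc(3) by (auto simp: R_def F_def equivariant_on_diff[OF f S])
  have "bij_betw F (f ` S) (S // R)"
    unfolding bij_betw_def
  proof
    show "inj_on F (f ` S)"
      by (rule inj_onI) (auto simp: F_def)
    have "S // R = (\<lambda>x. F (f x)) ` S"
      by (auto simp: quotient_def RF)
    then show "F ` f ` S = S // R" by (simp add: image_image)
  qed
  moreover have "F (x + y) = {\<omega> + \<eta> |\<omega> \<eta>. \<omega> \<in> F x \<and> \<eta> \<in> F y}" if "x \<in> f ` S" "y \<in> f ` S" for x y
  proof -
    from that obtain a where a: "a \<in> S" "f a = x" by auto
    \<comment> \<open>With one preimage \<open>a\<close> of \<open>x\<close> fixed, the remainder
      \<open>z - a\<close> lies over \<open>y\<close>.\<close>
    have "\<exists>\<omega> \<eta>. z = \<omega> + \<eta> \<and> \<omega> \<in> F x \<and> \<eta> \<in> F y" if "z \<in> F (x + y)" for z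
      using that a Sc by (intro exI[of _ a] exI[of _ "z - a"]) (auto simp: F_def equivariant_on_diff[OF f S])
    then show ?thesis by (auto simp: F_def fe Sc)
  qed
  \<comment> \<open>For \<open>c = 0\<close> the multiples of fibre elements give only 0, and the
    added kernel elements fill up the coset.\<close>
  moreover have "F (c *\<^sub>R x) = {c *\<^sub>R \<omega> + \<beta> |\<omega> \<beta>. \<omega> \<in> F x \<and> \<beta> \<in> {x \<in> S. f x = 0}}" if "x \<in> f ` S" for c x
  proof -
    from that obtain a where a: "a \<in> S" "f a = x" by auto
    have "\<exists>\<omega> \<beta>. z = c *\<^sub>R \<omega> + \<beta> \<and> \<omega> \<in> F x \<and> \<beta> \<in> {x \<in> S. f x = 0}" if "z \<in> F (c *\<^sub>R x)" for z
      using that a Sc by (intro exI[of _ a] exI[of _ "z - c *\<^sub>R a"])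
        (auto simp: F_def equivariant_on_diff[OF f S] fe)
    then show ?thesis by (auto simp: F_def fe Sc)
  qed
  moreover have "F (form_act g x) = form_act g ` F x" if g: "orthogonal_transformation g" for g x
  proof -
    \<comment> \<open>Acting by the inverse of \<open>g\<close> carries \<open>z\<close> into the
      fibre over \<open>x\<close>.\<close>
    have "z \<in> form_act g ` F x" if z: "z \<in> F (form_act g x)" for z
    proof -
      note g' = orthogonal_transformation_inv[OF g]
      have "inv (inv g) = g"
        by (rule inv_inv_eq[OF orthogonal_transformation_bij[OF g]])
      then have "form_act (inv g) (form_act g x) = x"
        using form_act_inv[OF g', of x] by simp
      then have "form_act (inv g) z \<in> F x"
        using z fe(3)[OF g'] Sc(5)[OF g'] by (simp add: F_def)
      then show ?thesis using form_act_inv[OF g, of z] by (metis imageI)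
    qed
    then show ?thesis using fe(3)[OF g] Sc(5)[OF g] by (auto simp: F_def)
  qed
  ultimately show ?thesis
    unfolding omodule_iso_def form_module_def quotient_module_def R_def
    by (intro exI[of _ F]) simp
qed

section \<open>Schur's lemma and kernels on direct sums\<close>

text \<open>The kernel is a submodule that misses \<open>x\<close>, hence zero by
  irreducibility.\<close>

lemma schur_injective:
  assumes "S = {0} \<or> irreducible_module S" "equivariant_on S f" "x \<in> S" "f x \<noteq> 0" "y \<in> S" "f y = 0"
  shows "y = 0"
proof (cases "S = {0}")
  case False
  then have S: "irreducible_module S" using assms(1) by simp
  then have "submodule {x \<in> S. f x = 0}"
    using submodule_kernel assms(2) by (auto simp: irreducible_module_def)
  then have "{x \<in> S. f x = 0} = {0} \<or> {x \<in> S. f x = 0} = S"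
    using S unfolding irreducible_module_def by blast
  then show ?thesis using assms by blast
qed (use assms in auto)

text \<open>Zero modules are exempt because several summands may vanish at once; the condition is
  that of \<open>harmonic_decomposition\<close>.\<close>

definition inequivalent :: "'n::finite form set \<Rightarrow> 'n form set \<Rightarrow> bool"
  where "inequivalent X Y \<longleftrightarrow> (X \<noteq> {0} \<and> Y \<noteq> {0} \<longrightarrow> \<not> form_module X \<simeq>\<^sub>O form_module Y)"

lemma inequivalent_sym: "submodule Y \<Longrightarrow> inequivalent X Y \<Longrightarrow> inequivalent Y X"
  using form_module_iso_sym[of Y X] unfolding inequivalent_def by blast

text \<open>A nonzero \<open>f\<close> followed by an isomorphism from \<open>T\<close> to
  \<open>W\<close> would be onto by irreducibility of \<open>W\<close> and injective by
  irreducibility of \<open>S\<close>, an isomorphism excluded by \<open>ne\<close>.\<close>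

lemma schur_zero:
  assumes S: "submodule S" "S = {0} \<or> irreducible_module S"
    and W: "submodule W" "W = {0} \<or> irreducible_module W"
    and f: "equivariant_on S f" "f ` S \<subseteq> T"
    and iso: "form_module W \<simeq>\<^sub>O form_module T"
    and ne: "inequivalent S W"
    and x: "x \<in> S"
  shows "f x = 0"
proof (rule ccontr)
  assume fx: "f x \<noteq> 0"
  obtain h where h: "bij_betw h T W" "equivariant_on T h"
    using form_module_iso_sym[OF W(1) iso] by (auto simp: form_module_iso_iff)
  note hf = equivariant_on_comp[OF f h(2)]
  have hfS: "(h \<circ> f) ` S \<subseteq> W"
    using bij_betw_imp_surj_on[OF h(1)] f(2) by fastforce
  have h0: "h 0 = 0" using equivariant_on_zero[OF h(2)] f(2) x by blast
  have "0 \<in> T"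
    using submoduleD(1)[OF submodule_image[OF S(1) f(1)]] f(2) by blast
  then have "h (f x) \<noteq> h 0"
    using bij_betw_imp_inj_on[OF h(1)] f(2) x fx by (auto dest!: inj_onD)
  then have nz: "(h \<circ> f) x \<noteq> 0" using h0 by simp
  have "(h \<circ> f) ` S = W"
  proof -
    have "W \<noteq> {0}" using nz hfS x by blast
    then have "irreducible_module W" using W(2) by simp
    then have "(h \<circ> f) ` S = {0} \<or> (h \<circ> f) ` S = W"
      using submodule_image[OF S(1) hf] hfS unfolding irreducible_module_def by blast
    then show ?thesis using nz x by blast
  qed
  moreover have "inj_on (h \<circ> f) S"
  proof (rule inj_onI)
    fix a b assume ab: "a \<in> S" "b \<in> S" "(h \<circ> f) a = (h \<circ> f) b"
    have "(h \<circ> f) (a - b) = 0"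
      unfolding equivariant_on_diff[OF hf S(1) ab(1,2)] using ab(3) by simp
    with submoduleD(3)[OF S(1) ab(1,2)] have "a - b = 0"
      by (rule schur_injective[OF S(2) hf x nz])
    then show "a = b" by simp
  qed
  ultimately have "form_module S \<simeq>\<^sub>O form_module W"
    using hf by (auto simp: form_module_iso_iff bij_betw_def)
  moreover have "S \<noteq> {0}" using equivariant_on_zero[OF f(1) x] x fx by blast
  moreover have "W \<noteq> {0}" using nz hfS x by blast
  ultimately show False using ne unfolding inequivalent_def by blast
qed

section \<open>Direct sums and kernels\<close>

lemma sum_list_replicate_zero: "sum_list (replicate n 0) = (0 :: 'a::comm_monoid_add)"
  by (induction n) auto

text \<open>An element of one summand is a sum whose other components are 0.\<close>

lemma direct_sum_component_subset:
  fixes K :: "'a::comm_monoid_add set"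
  assumes ds: "is_direct_sum K Ss" and z: "\<And>S. S \<in> set Ss \<Longrightarrow> 0 \<in> S" and S: "S \<in> set Ss"
  shows "S \<subseteq> K"
proof
  fix x assume x: "x \<in> S"
  obtain As Bs where Ss: "Ss = As @ S # Bs" using S by (auto simp: in_set_conv_decomp)
  have *: "list_all2 (\<in>) (replicate (length Xs) 0) Xs" if "set Xs \<subseteq> set Ss" for Xs
    unfolding list_all2_conv_all_nth
  proof (intro conjI allI impI)
    fix i assume "i < length (replicate (length Xs) (0::'a))"
    then have "Xs ! i \<in> set Ss" using that by (auto dest: nth_mem)
    then show "replicate (length Xs) 0 ! i \<in> Xs ! i" using z \<open>i < _\<close> by simp
  qed simp
  have "list_all2 (\<in>) (replicate (length As) 0 @ x # replicate (length Bs) 0) Ss"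
    unfolding Ss by (intro list_all2_appendI list_all2_Cons[THEN iffD2] conjI x *) (auto simp: Ss)
  then have "sum_list (replicate (length As) 0 @ x # replicate (length Bs) 0) \<in> K"
    using ds unfolding is_direct_sum_def by blast
  then show "x \<in> K" by (simp add: sum_list_replicate_zero)
qed

text \<open>Splits off the last summand: the value of \<open>f\<close> depends on the component in
  \<open>W\<close> alone, and \<open>f\<close> has trivial kernel there.\<close>

lemma direct_sum_kernel:
  fixes f :: "'a::real_vector \<Rightarrow> 'b::real_vector"
  assumes ds: "is_direct_sum K (Ss @ [W])" and K: "subspace K"
    and z: "\<And>S. S \<in> set (Ss @ [W]) \<Longrightarrow> 0 \<in> S"
    and add: "\<And>x y. x \<in> K \<Longrightarrow> y \<in> K \<Longrightarrow> f (x + y) = f x + f y"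
    and f0: "\<And>S x. S \<in> set Ss \<Longrightarrow> x \<in> S \<Longrightarrow> f x = 0"
    and nz: "W \<noteq> {0} \<Longrightarrow> \<exists>x\<in>K. f x \<noteq> 0"
    and inj: "\<And>x y. x \<in> W \<Longrightarrow> f x \<noteq> 0 \<Longrightarrow> y \<in> W \<Longrightarrow> f y = 0 \<Longrightarrow> y = 0"
  shows "is_direct_sum {x \<in> K. f x = 0} Ss"
proof -
  note sub = direct_sum_component_subset[OF ds z]
  have ex: "\<exists>xs. list_all2 (\<in>) xs (Ss @ [W]) \<and> x = sum_list xs" if "x \<in> K" for x
    using ds that unfolding is_direct_sum_def by blast
  have f00: "f 0 = 0" using add[of 0 0] subspace_0[OF K] by simp
  have ker: "sum_list xs \<in> K \<and> f (sum_list xs) = 0" if "\<forall>x\<in>set xs. x \<in> K \<and> f x = 0" for xs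
    using that by (induction xs) (auto simp: f00 add subspace_0[OF K] subspace_add[OF K])
  have Ss: "sum_list xs \<in> K \<and> f (sum_list xs) = 0" if "list_all2 (\<in>) xs Ss" for xs
  proof (rule ker, rule ballI)
    fix x assume "x \<in> set xs"
    then obtain i where "i < length xs" "x = xs ! i" by (auto simp: in_set_conv_nth)
    then have "Ss ! i \<in> set Ss" "x \<in> Ss ! i"
      using that by (auto simp: list_all2_conv_all_nth)
    then obtain S where "S \<in> set Ss" "x \<in> S" by blast
    with sub[of S] f0[of S x] show "x \<in> K \<and> f x = 0" by auto
  qed
  have decomp: "\<exists>xs w. list_all2 (\<in>) xs Ss \<and> w \<in> W \<and> x = sum_list xs + w \<and> f x = f w" if x: "x \<in> K" for x
  proof -
    obtain zs where "list_all2 (\<in>) zs (Ss @ [W])" "x = sum_list zs" using ex[OF x] by blast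
    then obtain xs w where "list_all2 (\<in>) xs Ss" "w \<in> W" "x = sum_list xs + w"
      by (auto simp: list_all2_append2 list_all2_Cons2)
    moreover from this have "f x = f w"
      using Ss[of xs] sub[of W] add by auto
    ultimately show ?thesis by blast
  qed
  \<comment> \<open>\<open>inj\<close> asks for an element of \<open>W\<close> with nonzero image;
    it is the \<open>W\<close>-component of the element of \<open>K\<close> provided by
    \<open>nz\<close>.\<close>
  have W0: "y = 0" if y: "y \<in> W" "f y = 0" for y
  proof (rule ccontr)
    assume "y \<noteq> 0"
    then obtain x where x: "x \<in> K" "f x \<noteq> 0" using nz y(1) by blast
    from decomp[OF x(1)] obtain w where "w \<in> W" "f w \<noteq> 0" using x(2) by metis
    from inj[OF this y] \<open>y \<noteq> 0\<close> show False by simp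
  qed
  show ?thesis
    unfolding is_direct_sum_def
  proof (intro conjI allI impI)
    show "{x \<in> K. f x = 0} = {sum_list xs |xs. list_all2 (\<in>) xs Ss}"
    proof (intro equalityI subsetI)
      fix x assume "x \<in> {x \<in> K. f x = 0}"
      then obtain xs w where *: "list_all2 (\<in>) xs Ss" "w \<in> W" "x = sum_list xs + w" "f w = 0"
        using decomp[of x] by auto
      then have "x = sum_list xs" using W0[of w] by simp
      with *(1) show "x \<in> {sum_list xs |xs. list_all2 (\<in>) xs Ss}" by blast
    qed (use Ss in auto)
  next
    fix xs ys assume "list_all2 (\<in>) xs Ss" "list_all2 (\<in>) ys Ss" "sum_list xs = sum_list ys"
    \<comment> \<open>Uniqueness is inherited by appending the zero component in
      \<open>W\<close>.\<close>
    then have "list_all2 (\<in>) (xs @ [0]) (Ss @ [W])" "list_all2 (\<in>) (ys @ [0]) (Ss @ [W])"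
      "sum_list (xs @ [0]) = sum_list (ys @ [0])"
      using z by (auto intro: list_all2_appendI)
    then have "xs @ [0] = ys @ [0]" using ds unfolding is_direct_sum_def by blast
    then show "xs = ys" by simp
  qed
qed

text \<open>By Schur's lemma \<open>f\<close> kills each summand in \<open>Ss\<close>, which is
  inequivalent to the image, and is injective on \<open>W\<close>. It is applied to split off
  \<open>W\<close>, then \<open>V\<close> or \<open>U\<close>.\<close>

lemma equivariant_kernel_direct_sum:
  assumes ds: "is_direct_sum K (Ss @ [W])" and K: "submodule K"
    and Ss: "\<And>S. S \<in> set (Ss @ [W]) \<Longrightarrow> submodule S \<and> (S = {0} \<or> irreducible_module S)"
    and f: "equivariant_on K f" and iso: "form_module W \<simeq>\<^sub>O form_module (f ` K)"
    and ne: "\<And>S. S \<in> set Ss \<Longrightarrow> inequivalent S W"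
  shows "is_direct_sum {x \<in> K. f x = 0} Ss"
proof (rule direct_sum_kernel[OF ds])
  show "subspace K" using K by (simp add: submodule_def)
  show z: "0 \<in> S" if "S \<in> set (Ss @ [W])" for S
    using Ss[OF that] by (blast intro: submoduleD(1))
  have sub: "S \<subseteq> K" if "S \<in> set (Ss @ [W])" for S
    by (rule direct_sum_component_subset[OF ds z that])
  show "f (x + y) = f x + f y" if "x \<in> K" "y \<in> K" for x y
    by (rule equivariant_onD(1)[OF f that])
  have W: "submodule W" "W = {0} \<or> irreducible_module W" "equivariant_on W f"
  proof -
    have "W \<in> set (Ss @ [W])" by simp
    from Ss[OF this] equivariant_on_subset[OF f sub[OF this]]
    show "submodule W" "W = {0} \<or> irreducible_module W" "equivariant_on W f" by blast+
  qed
  show "f x = 0" if S: "S \<in> set Ss" and x: "x \<in> S" for S x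
  proof -
    have "S \<in> set (Ss @ [W])" using S by simp
    note S' = Ss[OF this] sub[OF this]
    show ?thesis
      by (rule schur_zero[OF S'(1)[THEN conjunct1] S'(1)[THEN conjunct2] W(1,2)
            equivariant_on_subset[OF f S'(2)] image_mono[OF S'(2)] iso ne[OF S] x])
  qed
  show "\<exists>x\<in>K. f x \<noteq> 0" if "W \<noteq> {0}"
  proof -
    have "0 \<in> W" by (rule submoduleD(1)[OF W(1)])
    with that obtain x where x: "x \<in> W" "x \<noteq> 0" by blast
    obtain h where h: "inj_on h W" "h ` W = f ` K"
      using iso by (auto simp: form_module_iso_iff bij_betw_def)
    \<comment> \<open>A nonzero \<open>W\<close> yields two distinct elements of the image, which
      cannot both be 0.\<close>
    have "h x \<noteq> h 0" using inj_onD[OF h(1)] x \<open>0 \<in> W\<close> by blast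
    moreover have "h x \<in> f ` K" "h 0 \<in> f ` K" using h(2) x \<open>0 \<in> W\<close> by blast+
    ultimately show ?thesis by (metis imageE)
  qed
  show "y = 0" if "x \<in> W" "f x \<noteq> 0" "y \<in> W" "f y = 0" for x y
    using schur_injective[OF W(2,3) that] .
qed

lemma list_all2_Cons3:
  "list_all2 (\<in>) xs [A, B, C] \<longleftrightarrow> (\<exists>a\<in>A. \<exists>b\<in>B. \<exists>c\<in>C. xs = [a, b, c])"
  by (auto simp: list_all2_Cons2)

text \<open>Puts \<open>U\<close> last, the position from which
  \<open>equivariant_kernel_direct_sum\<close> splits off a summand.\<close>

lemma is_direct_sum_swap:
  fixes K :: "'a::comm_monoid_add set"
  assumes "is_direct_sum K [A, B, C]"
  shows "is_direct_sum K [A, C, B]"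
proof -
  have K: "K = {sum_list xs |xs. list_all2 (\<in>) xs [A, B, C]}"
    and uniq: "list_all2 (\<in>) xs [A, B, C] \<Longrightarrow> list_all2 (\<in>) ys [A, B, C] \<Longrightarrow>
      sum_list xs = sum_list ys \<Longrightarrow> xs = ys" for xs ys
    using assms unfolding is_direct_sum_def by blast+
  have sums: "{sum_list xs |xs. list_all2 (\<in>) xs [A, B, C]} =
      (\<lambda>(a, b, c). a + (b + c)) ` (A \<times> B \<times> C)" for A B C :: "'a set"
    unfolding list_all2_Cons3 by (force simp: image_def)
  have "(\<lambda>(a, b, c). a + (b + c)) ` (A \<times> B \<times> C) =
      (\<lambda>(a, b, c). a + (b + c)) ` (\<lambda>(a, c, b). (a, b, c)) ` (A \<times> C \<times> B)"
    by (rule arg_cong[of _ _ "image _"]) force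
  also have "\<dots> = (\<lambda>(a, b, c). a + (b + c)) ` (A \<times> C \<times> B)"
    unfolding image_image by (rule image_cong) (auto simp: ac_simps)
  finally have "K = {sum_list xs |xs. list_all2 (\<in>) xs [A, C, B]}"
    unfolding K sums .
  moreover have "xs = ys" if xs: "list_all2 (\<in>) xs [A, C, B]" and ys: "list_all2 (\<in>) ys [A, C, B]"
    and eq: "sum_list xs = sum_list ys" for xs ys
  proof -
    obtain a c b a' c' b' where *: "xs = [a, c, b]" "ys = [a', c', b']"
      "a \<in> A" "b \<in> B" "c \<in> C" "a' \<in> A" "b' \<in> B" "c' \<in> C"
      using xs ys unfolding list_all2_Cons3 by blast
    have "[a, b, c] = [a', b', c']"
      by (rule uniq) (use * eq in \<open>simp_all add: ac_simps\<close>)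
    then show ?thesis using * by simp
  qed
  ultimately show ?thesis unfolding is_direct_sum_def by blast
qed

section \<open>The differential and the codifferential as equivariant maps\<close>

lemma submodule_poly_forms: "submodule (poly_forms s k)"
  by (rule submoduleI) (simp_all add: poly_forms_zero poly_forms_add poly_forms_scaleR poly_forms_form_act)

lemma equivariant_dform: "equivariant_on (poly_forms s k) dform"
  by (simp add: equivariant_on_def dform_add dform_scaleR dform_form_act poly_forms_poly_coeffs)

lemma equivariant_codiff: "equivariant_on (poly_forms s k) codiff"
  by (simp add: equivariant_on_def codiff_add codiff_scaleR codiff_form_act poly_forms_poly_coeffs)

text \<open>Truncated subtraction does no harm: in polynomial degree 0 the differential is 0, which
  belongs to every space of forms.\<close>

lemma dform_image: "dform ` poly_forms s k \<subseteq> poly_forms (Suc s) (k - 1)"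
  using poly_forms_dform by (cases k) (auto simp: dform_degree_0 poly_forms_zero)

lemma codiff_image: "codiff ` poly_forms s k \<subseteq> poly_forms (s - 1) (k - 1)"
  using poly_forms_codiff
  by (cases s; cases k) (auto simp: codiff_degree_0 codiff_function poly_forms_zero)

lemma equivariant_dform_codiff: "equivariant_on (poly_forms s k) (dform \<circ> codiff)"
  by (rule equivariant_on_comp[OF equivariant_codiff codiff_image equivariant_dform])

lemma equivariant_codiff_dform: "equivariant_on (poly_forms s k) (codiff \<circ> dform)"
  by (rule equivariant_on_comp[OF equivariant_dform dform_image equivariant_codiff])

lemma equivariant_hodge_laplacian: "equivariant_on (poly_forms s k) hodge_laplacian"
  using equivariant_on_sum[OF equivariant_dform_codiff equivariant_codiff_dform]
  by (simp add: hodge_laplacian_def[abs_def])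

lemma submodule_Ker: "equivariant_on (poly_forms s k) T \<Longrightarrow> submodule (Ker s k T)"
  using submodule_kernel[OF submodule_poly_forms] by (simp add: Ker_def)

section \<open>Preimages of closed and coclosed forms\<close>

text \<open>The equation \<open>dform \<omega> = 0\<close> puts the preimage into the smallest
  domain allowed in \<open>iso_codiff_image\<close>.\<close>

lemma Hspace_codiff_preimage:
  fixes \<eta> :: "'n::finite form"
  assumes \<eta>: "\<eta> \<in> Hspace s k" and s: "s < CARD('n)"
  shows "\<exists>\<omega>\<in>poly_forms (Suc s) (Suc k). codiff \<omega> = \<eta> \<and> dform \<omega> = 0"
proof -
  have P: "\<eta> \<in> poly_forms s k" and d: "dform \<eta> = 0" "codiff \<eta> = 0"
    using \<eta> by (auto simp: Hspace_def)
  define c where "c = - (real k + real CARD('n) - real s)"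
  \<comment> \<open>The scalar is negative because \<open>s < CARD('n)\<close>.\<close>
  have c: "c \<noteq> 0" using s by (simp add: c_def)
  let ?e = "wedge (\<lambda>x. x) \<eta>"
  note e = poly_forms_wedge[OF P]
  show ?thesis
  proof (intro bexI conjI)
    show "(1 / c) *\<^sub>R ?e \<in> poly_forms (Suc s) (Suc k)"
      by (rule poly_forms_scaleR[OF e])
    show "codiff ((1 / c) *\<^sub>R ?e) = \<eta>"
    proof -
      have "codiff ?e = c *\<^sub>R \<eta>" by (simp add: codiff_wedge[OF P] d c_def)
      then show ?thesis using c by (simp add: codiff_scaleR poly_forms_poly_coeffs[OF e])
    qed
    show "dform ((1 / c) *\<^sub>R ?e) = 0"
      by (simp add: dform_scaleR dform_wedge poly_forms_poly_coeffs[OF e] poly_forms_poly_coeffs[OF P] d)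
  qed
qed

text \<open>The preimage is coclosed for the corresponding use in
  \<open>iso_dform_image\<close>.\<close>

lemma Hspace_dform_preimage:
  fixes \<eta> :: "'n::finite form"
  assumes \<eta>: "\<eta> \<in> Hspace (Suc s) k"
  shows "\<exists>\<omega>\<in>poly_forms s (Suc k). dform \<omega> = \<eta> \<and> codiff \<omega> = 0"
proof -
  have P: "\<eta> \<in> poly_forms (Suc s) k" and d: "dform \<eta> = 0" "codiff \<eta> = 0"
    using \<eta> by (auto simp: Hspace_def)
  define c where "c = real (k + Suc s)"
  have c: "c \<noteq> 0" by (simp add: c_def)
  note i = poly_forms_radial_contract[OF P]
  show ?thesis
  proof (intro bexI conjI)
    show "(1 / c) *\<^sub>R radial_contract \<eta> \<in> poly_forms s (Suc k)"
      by (rule poly_forms_scaleR[OF i])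
    show "dform ((1 / c) *\<^sub>R radial_contract \<eta>) = \<eta>"
    proof -
      have "dform (radial_contract \<eta>) = c *\<^sub>R \<eta>" by (simp add: dform_radial_contract[OF P] d c_def)
      then show ?thesis using c by (simp add: dform_scaleR poly_forms_poly_coeffs[OF i])
    qed
    show "codiff ((1 / c) *\<^sub>R radial_contract \<eta>) = 0"
      by (simp add: codiff_scaleR codiff_radial_contract[OF P] poly_forms_poly_coeffs[OF i] d)
  qed
qed

text \<open>The two prescribed values are opposite, so the preimage is harmonic.\<close>

lemma Hspace_laplacian_preimage:
  fixes \<eta> :: "'n::finite form"
  assumes \<eta>: "\<eta> \<in> Hspace s k" and s: "1 \<le> s" "s < CARD('n)"
  shows "\<exists>\<omega>\<in>poly_forms s (Suc (Suc k)). dform (codiff \<omega>) = \<eta> \<and> codiff (dform \<omega>) = - \<eta>"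
proof -
  obtain r where r: "s = Suc r" using s by (cases s) auto
  have P: "\<eta> \<in> poly_forms s k" and d: "dform \<eta> = 0" "codiff \<eta> = 0"
    using \<eta> by (auto simp: Hspace_def)
  \<comment> \<open>The constants of \<open>dform_radial_contract\<close> and
    \<open>codiff_wedge\<close> on \<eta>. Below, \<open>B + 2\<close> belongs to \<open>i\<close>
    and \<open>A + 2\<close> to \<open>e\<close>: the polynomial degree is one higher in both, the
    form degree one lower in \<open>i\<close> and one higher in \<open>e\<close>.\<close>
  define A B where "A = real k + real s" and "B = real k + real CARD('n) - real s"
  have AB: "A > 0" "B > 0" using s by (simp_all add: A_def B_def)
  define i where "i = radial_contract \<eta>"
  define e where "e = wedge (\<lambda>x. x) \<eta>"
  define p where "p = wedge (\<lambda>x. x) i"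
  define q where "q = radial_contract e"
  have i: "i \<in> poly_forms r (Suc k)"
    unfolding i_def using P r by (simp add: poly_forms_radial_contract)
  have e: "e \<in> poly_forms (Suc s) (Suc k)"
    unfolding e_def by (rule poly_forms_wedge[OF P])
  have p: "p \<in> poly_forms s (Suc (Suc k))"
    unfolding p_def r by (rule poly_forms_wedge[OF i])
  have q: "q \<in> poly_forms s (Suc (Suc k))"
    unfolding q_def by (rule poly_forms_radial_contract[OF e])
  note pc = P[THEN poly_forms_poly_coeffs] i[THEN poly_forms_poly_coeffs] e[THEN poly_forms_poly_coeffs]
    p[THEN poly_forms_poly_coeffs] q[THEN poly_forms_poly_coeffs]
  have di: "dform i = A *\<^sub>R \<eta>" "codiff i = 0"
    using dform_radial_contract[OF P] codiff_radial_contract[OF P] by (simp_all add: i_def d A_def)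
  have de: "dform e = 0" "codiff e = - B *\<^sub>R \<eta>"
    using dform_wedge[OF pc(1)] codiff_wedge[OF P] by (simp_all add: e_def d B_def)
  have dp: "dform p = - A *\<^sub>R e" "codiff p = - (B + 2) *\<^sub>R i"
    using dform_wedge[OF pc(2)] codiff_wedge[OF i]
    by (simp_all add: p_def di wedge_scaleR e_def B_def r algebra_simps)
  have dq: "dform q = (A + 2) *\<^sub>R e" "codiff q = B *\<^sub>R i"
    using dform_radial_contract[OF e] codiff_radial_contract[OF e]
    by (simp_all add: q_def de A_def r algebra_simps i_def radial_contract_scaleR flip: scaleR_minus_left)
  \<comment> \<open>For a combination of \<open>p\<close> and \<open>q\<close> with weights
    \<open>a\<close> and \<open>b\<close> the requirements read
    \<open>A * (B * b - (B + 2) * a) = 1\<close> and \<open>B * ((A + 2) * b - A * a) = 1\<close>;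
    the solution is \<open>a = B / c\<close>, \<open>b = - A / c\<close>.\<close>
  define c where "c = - (A * B * (A + B + 2))"
  have c: "c \<noteq> 0" using AB by (simp add: c_def)
  define \<omega> where "\<omega> = (B / c) *\<^sub>R p + (- A / c) *\<^sub>R q"
  have "codiff \<omega> = (- (B * (A + B + 2)) / c) *\<^sub>R i"
    unfolding \<omega>_def codiff_add[OF pc(4,5)[THEN poly_coeffs_scaleR]] codiff_scaleR[OF pc(4)]
      codiff_scaleR[OF pc(5)] dp dq
    by (simp add: divide_simps c flip: scaleR_add_left scaleR_minus_left) (simp add: algebra_simps)
  moreover have "dform \<omega> = (- (A * (A + B + 2)) / c) *\<^sub>R e"
    unfolding \<omega>_def dform_add[OF pc(4,5)[THEN poly_coeffs_scaleR]] dform_scaleR[OF pc(4)]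
      dform_scaleR[OF pc(5)] dp dq
    by (simp add: divide_simps c flip: scaleR_add_left scaleR_minus_left) (simp add: algebra_simps)
  ultimately have "dform (codiff \<omega>) = (c / c) *\<^sub>R \<eta>" "codiff (dform \<omega>) = - (c / c) *\<^sub>R \<eta>"
    by (simp_all add: dform_scaleR codiff_scaleR pc di de c_def algebra_simps)
  moreover have "\<omega> \<in> poly_forms s (Suc (Suc k))"
    unfolding \<omega>_def by (intro poly_forms_add poly_forms_scaleR p q)
  ultimately show ?thesis using c by auto
qed

section \<open>The decomposition of harmonic forms\<close>

lemma dform_codiff_hodge_laplacian:
  "hodge_laplacian \<omega> = 0 \<Longrightarrow> dform (codiff \<omega>) = - codiff (dform \<omega>)"
  by (simp add: hodge_laplacian_def add_eq_0_iff2)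

text \<open>\<open>S\<close> may lie anywhere between the two bounds since the preimages found above
  are closed. It is the whole kernel of \<open>dform \<circ> codiff\<close> for (a), and its
  intersection with the kernel of \<open>codiff \<circ> dform\<close> for (c).\<close>

lemma iso_codiff_image:
  fixes U :: "'n::finite form set"
  assumes s: "s \<le> CARD('n)"
    and U: "if 1 \<le> s \<and> 1 \<le> k
      then form_module U \<simeq>\<^sub>O form_module (Hspace (s - 1) (k - 1) :: 'n form set) else U = {0}"
    and S: "Ker s k (dform \<circ> codiff) \<inter> Ker s k dform \<subseteq> S" "S \<subseteq> Ker s k (dform \<circ> codiff)"
  shows "form_module U \<simeq>\<^sub>O form_module (codiff ` S)"
proof (cases "1 \<le> s \<and> 1 \<le> k")
  case True
  then obtain r l where rl: "s = Suc r" "k = Suc l" by (metis Suc_le_D One_nat_def)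
  have "codiff ` S \<subseteq> Hspace r l"
  proof
    fix \<eta> assume "\<eta> \<in> codiff ` S"
    then obtain \<omega> where \<omega>: "\<omega> \<in> poly_forms s k" "dform (codiff \<omega>) = 0" "\<eta> = codiff \<omega>"
      using S(2) by (auto simp: Ker_def)
    then show "\<eta> \<in> Hspace r l"
      using poly_forms_codiff[of \<omega> r l] codiff_codiff[of \<omega>] by (simp add: Hspace_def rl)
  qed
  moreover have "\<eta> \<in> codiff ` S" if \<eta>: "\<eta> \<in> Hspace r l" for \<eta>
  proof -
    obtain \<omega> where "\<omega> \<in> poly_forms s k" "codiff \<omega> = \<eta>" "dform \<omega> = 0"
      using Hspace_codiff_preimage[OF \<eta>] s rl by auto
    moreover from this have "\<omega> \<in> S"
      using S(1) \<eta> by (auto simp: Ker_def Hspace_def)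
    ultimately show ?thesis by blast
  qed
  ultimately have "codiff ` S = Hspace r l" by blast
  with True U rl show ?thesis by simp
next
  case False
  \<comment> \<open>In the excluded degrees both \<open>U\<close> and the image are 0.\<close>
  have "codiff \<omega> = 0" if "\<omega> \<in> S" for \<omega>
    using that S(2) False codiff_degree_0[of \<omega> s] codiff_function[of \<omega> k]
    by (auto simp: Ker_def not_less_eq_eq)
  moreover have "0 \<in> S" using S(1) by (auto simp: Ker_def poly_forms_zero)
  ultimately have "codiff ` S = {0}" by force
  moreover have "U = {0}" using U False by (simp split: if_splits)
  ultimately show ?thesis by (simp add: omodule_iso_refl)
qed

text \<open>Dual to \<open>iso_codiff_image\<close>; the excluded degrees are \<open>k = 0\<close>
  and form degrees from \<open>CARD('n)\<close> on.\<close>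

lemma iso_dform_image:
  fixes V :: "'n::finite form set"
  assumes V: "if s < CARD('n) \<and> 1 \<le> k
      then form_module V \<simeq>\<^sub>O form_module (Hspace (s + 1) (k - 1) :: 'n form set) else V = {0}"
    and S: "Ker s k (codiff \<circ> dform) \<inter> Ker s k codiff \<subseteq> S" "S \<subseteq> Ker s k (codiff \<circ> dform)"
  shows "form_module V \<simeq>\<^sub>O form_module (dform ` S)"
proof (cases "s < CARD('n) \<and> 1 \<le> k")
  case True
  then obtain l where l: "k = Suc l" by (metis Suc_le_D One_nat_def)
  have "dform ` S \<subseteq> Hspace (Suc s) l"
  proof
    fix \<eta> assume "\<eta> \<in> dform ` S"
    then obtain \<omega> where \<omega>: "\<omega> \<in> poly_forms s k" "codiff (dform \<omega>) = 0" "\<eta> = dform \<omega>"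
      using S(2) by (auto simp: Ker_def)
    then show "\<eta> \<in> Hspace (Suc s) l"
      using poly_forms_dform[of \<omega> s l] dform_dform[OF poly_forms_poly_coeffs] by (simp add: Hspace_def l)
  qed
  moreover have "\<eta> \<in> dform ` S" if \<eta>: "\<eta> \<in> Hspace (Suc s) l" for \<eta>
  proof -
    obtain \<omega> where "\<omega> \<in> poly_forms s k" "dform \<omega> = \<eta>" "codiff \<omega> = 0"
      using Hspace_dform_preimage[OF \<eta>] l by auto
    moreover from this have "\<omega> \<in> S"
      using S(1) \<eta> by (auto simp: Ker_def Hspace_def)
    ultimately show ?thesis by blast
  qed
  ultimately have "dform ` S = Hspace (Suc s) l" by blast
  with True V l show ?thesis by simp
next
  case False
  have "dform \<omega> = 0" if "\<omega> \<in> S" for \<omega>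
    using that S(2) False dform_degree_0[of \<omega> s] dform_top[of \<omega> s k]
    by (auto simp: Ker_def not_less_eq_eq)
  moreover have "0 \<in> S" using S(1) by (auto simp: Ker_def poly_forms_zero)
  ultimately have "dform ` S = {0}" by force
  moreover have "V = {0}" using V False by (simp split: if_splits)
  ultimately show ?thesis by (simp add: omodule_iso_refl)
qed

text \<open>On harmonic forms \<open>dform (codiff \<omega>)\<close> equals
  \<open>- codiff (dform \<omega>)\<close>, so the image is closed and coclosed;
  \<open>Hspace_laplacian_preimage\<close> shows that all such forms occur.\<close>

lemma iso_dform_codiff_image:
  fixes W :: "'n::finite form set"
  assumes s: "s \<le> CARD('n)"
    and W: "if 1 \<le> s \<and> s < CARD('n) \<and> 2 \<le> k
      then form_module W \<simeq>\<^sub>O form_module (Hspace s (k - 2) :: 'n form set) else W = {0}"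
  shows "form_module W \<simeq>\<^sub>O form_module ((dform \<circ> codiff) ` Ker s k hodge_laplacian)"
proof (cases "1 \<le> s \<and> s < CARD('n) \<and> 2 \<le> k")
  case True
  then obtain r l where rl: "s = Suc r" "k = Suc (Suc l)"
    by (metis Suc_le_D One_nat_def add_2_eq_Suc le_Suc_ex)
  have "(dform \<circ> codiff) ` Ker s k hodge_laplacian \<subseteq> (Hspace s l :: 'n form set)"
  proof
    fix \<eta> assume "\<eta> \<in> (dform \<circ> codiff) ` Ker s k hodge_laplacian"
    then obtain \<omega> where \<omega>: "\<omega> \<in> poly_forms s k" "hodge_laplacian \<omega> = 0" "\<eta> = dform (codiff \<omega>)"
      by (auto simp: Ker_def)
    have P: "codiff \<omega> \<in> poly_forms r (Suc l)" using poly_forms_codiff[of \<omega> r "Suc l"] \<omega>(1) rl by simp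
    have Q: "dform \<omega> \<in> poly_forms (Suc s) (Suc l)" using poly_forms_dform[of \<omega> s "Suc l"] \<omega>(1) rl by simp
    have "dform \<eta> = 0" using \<omega>(3) dform_dform[OF poly_forms_poly_coeffs[OF P]] by simp
    moreover have "\<eta> = (-1) *\<^sub>R codiff (dform \<omega>)"
      using dform_codiff_hodge_laplacian[OF \<omega>(2)] \<omega>(3) by simp
    then have "codiff \<eta> = 0"
      using codiff_scaleR[OF poly_coeffs_codiff[OF poly_forms_poly_coeffs[OF Q]], of "-1"]
        codiff_codiff[OF Q] by simp
    ultimately show "\<eta> \<in> Hspace s l"
      using \<omega>(3) poly_forms_dform[OF P] rl by (simp add: Hspace_def)
  qed
  moreover have "\<eta> \<in> (dform \<circ> codiff) ` Ker s k hodge_laplacian"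
    if \<eta>: "\<eta> \<in> Hspace s l" for \<eta> :: "'n form"
  proof -
    obtain \<omega> where \<omega>: "\<omega> \<in> poly_forms s k" "dform (codiff \<omega>) = \<eta>" "codiff (dform \<omega>) = - \<eta>"
      using Hspace_laplacian_preimage[OF \<eta>] True rl by auto
    then have "\<omega> \<in> Ker s k hodge_laplacian" by (simp add: Ker_def hodge_laplacian_def)
    with \<omega>(2) show ?thesis by (auto intro: image_eqI[of _ _ \<omega>])
  qed
  ultimately have "(dform \<circ> codiff) ` Ker s k hodge_laplacian = (Hspace s l :: 'n form set)" by blast
  with True W rl show ?thesis by simp
next
  case False
  have "dform (codiff \<omega>) = 0" if \<omega>: "\<omega> \<in> Ker s k hodge_laplacian" for \<omega> :: "'n form"
  proof -
    have P: "\<omega> \<in> poly_forms s k" using \<omega> by (simp add: Ker_def)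
    \<comment> \<open>The truncated \<open>k - 1 = 0\<close> covers \<open>k = 0\<close> and
      \<open>k = 1\<close>, where \<open>codiff \<omega>\<close> has constant coefficients.\<close>
    consider "s = 0" | "s = CARD('n)" | "k - 1 = 0" using False s by linarith
    then show ?thesis
    proof cases
      case 1
      then show ?thesis using codiff_function[of \<omega> k] P by simp
    next
      case 2
      \<comment> \<open>In top degree \<open>dform \<omega> = 0\<close>, and harmonicity transfers
        this to \<open>dform (codiff \<omega>)\<close>.\<close>
      then show ?thesis
        using dform_top[OF P] dform_codiff_hodge_laplacian[of \<omega>] \<omega> by (simp add: Ker_def)
    next
      case 3
      have "codiff \<omega> \<in> poly_forms (s - 1) (k - 1)" using codiff_image P by blast
      then show ?thesis using 3 dform_degree_0 by simp
    qed
  qed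
  moreover have "(0 :: 'n form) \<in> Ker s k hodge_laplacian"
    by (simp add: Ker_def poly_forms_zero hodge_laplacian_def)
  ultimately have "(dform \<circ> codiff) ` Ker s k hodge_laplacian = {0 :: 'n form}" by force
  moreover have "W = {0}" using W False by (simp split: if_splits)
  ultimately show ?thesis by (simp add: omodule_iso_refl)
qed

theorem theorem3:
  fixes s k :: nat and U V W :: "'n::finite form set"
  assumes "s \<le> CARD('n)"
    and "harmonic_decomposition s k U V W"
  shows "(form_module U \<simeq>\<^sub>O Ker s k (dform \<circ> codiff) /\<^sub>O Ker s k codiff \<and>
      form_module V \<simeq>\<^sub>O Ker s k (codiff \<circ> dform) /\<^sub>O Ker s k dform) \<and>
    form_module W \<simeq>\<^sub>O
      Ker s k hodge_laplacian /\<^sub>O (Ker s k (dform \<circ> codiff) \<inter> Ker s k (codiff \<circ> dform)) \<and>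
    (is_direct_sum (Ker s k (dform \<circ> codiff) \<inter> Ker s k dform) [Hspace s k, U] \<and>
      is_direct_sum (Ker s k (codiff \<circ> dform) \<inter> Ker s k codiff) [Hspace s k, V]) \<and>
    is_direct_sum (Ker s k (dform \<circ> codiff) \<inter> Ker s k (codiff \<circ> dform)) [Hspace s k, U, V]"
proof -
  let ?H = "Hspace s k :: 'n form set"
  let ?A = "Ker s k (dform \<circ> codiff) :: 'n form set" and ?B = "Ker s k (codiff \<circ> dform) :: 'n form set"
  let ?L = "Ker s k hodge_laplacian :: 'n form set"
  have mods: "submodule X \<and> (X = {0} \<or> irreducible_module X)" if "X \<in> {?H, U, V, W}" for X
    using assms(2) that unfolding harmonic_decomposition_def by blast
  have ineq: "sorted_wrt inequivalent [?H, U, V, W]"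
    and ds: "is_direct_sum ?L [?H, U, V, W]"
    and iso:
      "if 1 \<le> s \<and> 1 \<le> k
       then form_module U \<simeq>\<^sub>O form_module (Hspace (s - 1) (k - 1) :: 'n form set) else U = {0}"
      "if s < CARD('n) \<and> 1 \<le> k
       then form_module V \<simeq>\<^sub>O form_module (Hspace (s + 1) (k - 1) :: 'n form set) else V = {0}"
      "if 1 \<le> s \<and> s < CARD('n) \<and> 2 \<le> k
       then form_module W \<simeq>\<^sub>O form_module (Hspace s (k - 2) :: 'n form set) else W = {0}"
    using assms(2) unfolding harmonic_decomposition_def inequivalent_def[abs_def] by blast+
  have ne: "inequivalent ?H U" "inequivalent ?H V" "inequivalent ?H W"
    "inequivalent U V" "inequivalent U W" "inequivalent V W"
    using ineq by simp_all
  \<comment> \<open>The decomposition records each pair in one order only; splitting off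
    \<open>U\<close> needs this one reversed.\<close>
  have VU: "inequivalent V U"
    using inequivalent_sym mods[of V] ne(4) by blast
  note dd = equivariant_dform_codiff equivariant_codiff_dform equivariant_hodge_laplacian
  note sub = dd[THEN submodule_Ker]
  \<comment> \<open>For harmonic forms the vanishing of one second-order term forces that of the
    other.\<close>
  have AB: "{x \<in> ?L. (dform \<circ> codiff) x = 0} = ?A \<inter> ?B"
    by (auto simp: Ker_def hodge_laplacian_def)
  \<comment> \<open>A closed form lies in \<open>?B\<close> automatically, because
    \<open>codiff 0 = 0\<close>; dually for \<open>Bd\<close>.\<close>
  have Ad: "{x \<in> ?A \<inter> ?B. dform x = 0} = ?A \<inter> Ker s k dform"
    by (auto simp: Ker_def)
  have Bd: "{x \<in> ?A \<inter> ?B. codiff x = 0} = ?B \<inter> Ker s k codiff"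
    by (auto simp: Ker_def)
  have P: "?A \<subseteq> poly_forms s k" "?B \<subseteq> poly_forms s k" "?L \<subseteq> poly_forms s k"
    "?A \<inter> ?B \<subseteq> poly_forms s k"
    by (auto simp: Ker_def)
  note eq_dc = equivariant_on_subset[OF equivariant_dform_codiff P(3)]
    and eq_d = P(4,2)[THEN equivariant_on_subset[OF equivariant_dform]]
    and eq_c = P(4,1)[THEN equivariant_on_subset[OF equivariant_codiff]]
  note Wiso = iso_dform_codiff_image[OF assms(1) iso(3)]
  \<comment> \<open>This is (d): \<open>dform \<circ> codiff\<close> splits \<open>W\<close> off the
    harmonic forms.\<close>
  have UVW: "is_direct_sum (?A \<inter> ?B) [?H, U, V]"
    unfolding AB[symmetric]
  proof (rule equivariant_kernel_direct_sum)
    show "is_direct_sum (?L) ([?H, U, V] @ [W])" using ds by simp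
    show "submodule X \<and> (X = {0} \<or> irreducible_module X)" if "X \<in> set ([?H, U, V] @ [W])" for X
      by (rule mods) (use that in auto)
    show "inequivalent X W" if "X \<in> set [?H, U, V]" for X
      using that ne by auto
  qed (rule sub(3) eq_dc Wiso)+
  have Viso: "form_module V \<simeq>\<^sub>O form_module (dform ` (?A \<inter> ?B))"
    by (rule iso_dform_image[OF iso(2)]) (auto simp: Ker_def)
  have Uiso: "form_module U \<simeq>\<^sub>O form_module (codiff ` (?A \<inter> ?B))"
    by (rule iso_codiff_image[OF assms(1) iso(1)]) (auto simp: Ker_def)
  \<comment> \<open>Inside the sum just obtained, \<open>dform\<close> splits off \<open>V\<close>;
    in \<open>c2\<close>, \<open>codiff\<close> splits off \<open>U\<close>.\<close>
  have c1: "is_direct_sum (?A \<inter> Ker s k dform) [?H, U]"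
    unfolding Ad[symmetric]
  proof (rule equivariant_kernel_direct_sum)
    show "is_direct_sum (?A \<inter> ?B) ([?H, U] @ [V])" using UVW by simp
    show "submodule X \<and> (X = {0} \<or> irreducible_module X)" if "X \<in> set ([?H, U] @ [V])" for X
      by (rule mods) (use that in auto)
    show "inequivalent X V" if "X \<in> set [?H, U]" for X
      using that ne by auto
  qed (rule submodule_Int[OF sub(1,2)] eq_d(1) Viso)+
  have c2: "is_direct_sum (?B \<inter> Ker s k codiff) [?H, V]"
    unfolding Bd[symmetric]
  proof (rule equivariant_kernel_direct_sum)
    show "is_direct_sum (?A \<inter> ?B) ([?H, V] @ [U])" using is_direct_sum_swap[OF UVW] by simp
    show "submodule X \<and> (X = {0} \<or> irreducible_module X)" if "X \<in> set ([?H, V] @ [U])" for X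
      by (rule mods) (use that in auto)
    show "inequivalent X U" if "X \<in> set [?H, V]" for X
      using that ne VU by auto
  qed (rule submodule_Int[OF sub(1,2)] eq_c(1) Uiso)+
  have a1: "form_module U \<simeq>\<^sub>O ?A /\<^sub>O Ker s k codiff"
  proof -
    have K: "{x \<in> ?A. codiff x = 0} = Ker s k codiff" by (auto simp: Ker_def)
    show ?thesis
      using omodule_iso_trans[OF iso_codiff_image[OF assms(1) iso(1) Int_lower1 order_refl]
          image_iso_quotient[OF sub(1) eq_c(2)]] unfolding K .
  qed
  have a2: "form_module V \<simeq>\<^sub>O ?B /\<^sub>O Ker s k dform"
  proof -
    have K: "{x \<in> ?B. dform x = 0} = Ker s k dform" by (auto simp: Ker_def)
    show ?thesis
      using omodule_iso_trans[OF iso_dform_image[OF iso(2) Int_lower1 order_refl]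
          image_iso_quotient[OF sub(2) eq_d(2)]] unfolding K .
  qed
  have b: "form_module W \<simeq>\<^sub>O ?L /\<^sub>O (?A \<inter> ?B)"
    using omodule_iso_trans[OF Wiso image_iso_quotient[OF sub(3) eq_dc]] unfolding AB .
  show ?thesis by (intro conjI a1 a2 b c1 c2 UVW)
qed

end
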